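(* Consider the directed network model, the statistics $v_{i,n}$ and $v_i$, and the $\sigma$-fields $\mathcal B^k_{i,n}$ and $\mathcal B^k_i$ described in the context, with $\kappa_u\ge1$ a fixed finite integer. Let $\mu_{i,n}=E[v_{i,n}]$ and $\mu_i=E[v_i]$, and assume $\sup_i\left\{|\mu_{i,n}|+(E[v_{i,n}^2])^{1/2}\right\}\le K<\infty$ for some constant $K$. Then $\mu_i=\mu$ does not depend on $i$ and: (i) $\left\|\mu_{i,n}-E[v_{i,n}\mid\mathcal B^k_{i,n}]\right\|_{2,\zeta}=0$ for $k>\kappa_u$, and $\left\|\mu_i-E[v_i\mid\mathcal B^k_i]\right\|_{2,\zeta}=0$ for $k>\kappa_u$. (ii) $n^{-1}\sum_{i=1}^n(v_{i,n}-\mu_{i,n})\to0$ almost surely and $n^{-1}\sum_{i=1}^nv_i\to\mu$ almost surely. (iii) For some constant $\sigma^2\ge 0$ (the same for both statements), $n^{-1/2}\sum_{i=1}^n(v_{i,n}-\mu_{i,n})\to_dN(0,\sigma^2)$ and $n^{-1/2}\sum_{i=1}^n(v_i-\mu)\to_dN(0,\sigma^2)$.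
   Context: Network model. For each agent $i\in\{1,\dots,n\}$ there are infinite sequences of random variables $\{\zeta_{ij}\}_{j=-\infty}^\infty$ and $\{\epsilon_{ij}\}_{j=-\infty}^\infty$. The $\zeta_{ij}=\zeta_{ji}$ are (apart from this symmetry) independently distributed, $\zeta_{ij}$ being uniform on $[|i-j|-1,|i-j|)$. The $\epsilon_{ij}$ are i.i.d. with the logistic distribution, independent of $\zeta=(\zeta_{ij})$; in particular $\epsilon_{ij}$ is independent of $\epsilon_{ji}$. Links are $$d_{ij}=1\{-|\zeta_{ij}|+\epsilon_{ij}>0\}\,1\{|\zeta_{ij}|<\kappa_u\}\quad(i\ne j),\qquad d_{ii}=0.$$ Statistics. $v_{i,n}=v_{i,n}(\zeta)=\sum_{j=1}^nd_{ij}$ and $v_i=v_i(\zeta)=\sum_{j=-\kappa_u-1}^{n+\kappa_u+1}d_{ij}$ for $i\in\{1,\dots,n\}$. $\sigma$-fields. Let $H(x)=e^x/(1+e^x)$, $g_{ij}(\zeta)=H(-|\zeta_{ij}|)$ and $\Lambda(k)=H(-k)$. $\mathcal B^k_{i,n}$ is the $\sigma$-field generated by $v_{j,n}(\zeta)1\{g_{ij}(\zeta)\le\Lambda(k)\}$, $j\in\{1,\dots,n\}$, $j\ne i$. $\mathcal B^k_i$ is the $\sigma$-field generated by $v_j(\zeta)1\{g_{ij}(\zeta)\le\Lambda(k)\}$, $j\in\{1,\dots,n\}$, $j\ne i$. $\|x\|_{2,\zeta}=(E[|x|^2\mid\zeta])^{1/2}$. *)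

theory Defs
  imports "HOL-Probability.Probability"
begin

definition H :: "real \<Rightarrow> real" where
  "H x = exp x / (1 + exp x)"

definition Lam :: "real \<Rightarrow> real" where
  "Lam k = H (- k)"

text \<open>Agents are the integers \<open>i \<ge> 1\<close> (so that the sample size can grow), potential neighbours
  range over all integers.\<close>

definition pairs :: "(int \<times> int) set" where
  "pairs = {1..} \<times> UNIV"

text \<open>One representative of each unordered pair: \<open>(i, j)\<close> and \<open>(j, i)\<close> both lie in \<open>pairs\<close>
  exactly when \<open>i, j \<ge> 1\<close>.\<close>

definition unordered_pairs :: "(int \<times> int) set" where
  "unordered_pairs = {(i, j). 1 \<le> i \<and> (1 \<le> j \<longrightarrow> i \<le> j)}"

locale network_model = prob_space M
  for M :: "'a measure" and \<zeta> \<epsilon> :: "int \<Rightarrow> int \<Rightarrow> 'a \<Rightarrow> real" +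
  assumes zeta_sym: "\<lbrakk>1 \<le> i; 1 \<le> j\<rbrakk> \<Longrightarrow> \<zeta> i j = \<zeta> j i"
    and zeta_indep: "indep_vars (\<lambda>_. borel) (\<lambda>(i, j). \<zeta> i j) unordered_pairs"
    and zeta_uniform: "1 \<le> i \<Longrightarrow>
      distr M borel (\<zeta> i j) = uniform_measure lborel {real_of_int \<bar>i - j\<bar> - 1 ..< real_of_int \<bar>i - j\<bar>}"
    and eps_indep: "indep_vars (\<lambda>_. borel) (\<lambda>(i, j). \<epsilon> i j) pairs"
    and eps_logistic: "1 \<le> i \<Longrightarrow> cdf (distr M borel (\<epsilon> i j)) = H"
    and zeta_eps_indep:
      "indep_var (Pi\<^sub>M pairs (\<lambda>_. borel)) (\<lambda>\<omega>. \<lambda>p\<in>pairs. \<zeta> (fst p) (snd p) \<omega>)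
                 (Pi\<^sub>M pairs (\<lambda>_. borel)) (\<lambda>\<omega>. \<lambda>p\<in>pairs. \<epsilon> (fst p) (snd p) \<omega>)"

definition link ::
  "int \<Rightarrow> (int \<Rightarrow> int \<Rightarrow> 'a \<Rightarrow> real) \<Rightarrow> (int \<Rightarrow> int \<Rightarrow> 'a \<Rightarrow> real) \<Rightarrow> int \<Rightarrow> int \<Rightarrow> 'a \<Rightarrow> real" where
  "link \<kappa> \<zeta> \<epsilon> i j \<omega> =
     (if i = j then 0
      else of_bool (- \<bar>\<zeta> i j \<omega>\<bar> + \<epsilon> i j \<omega> > 0) * of_bool (\<bar>\<zeta> i j \<omega>\<bar> < real_of_int \<kappa>))"

text \<open>\<open>v_trunc\<close> is $v_{i,n}$ and \<open>v_full\<close> is $v_i$; the latter also carries the argument \<open>n\<close>, because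
  its range of summation does.\<close>

definition v_trunc ::
  "int \<Rightarrow> (int \<Rightarrow> int \<Rightarrow> 'a \<Rightarrow> real) \<Rightarrow> (int \<Rightarrow> int \<Rightarrow> 'a \<Rightarrow> real) \<Rightarrow> nat \<Rightarrow> int \<Rightarrow> 'a \<Rightarrow> real" where
  "v_trunc \<kappa> \<zeta> \<epsilon> n i \<omega> = (\<Sum>j = 1..int n. link \<kappa> \<zeta> \<epsilon> i j \<omega>)"

definition v_full ::
  "int \<Rightarrow> (int \<Rightarrow> int \<Rightarrow> 'a \<Rightarrow> real) \<Rightarrow> (int \<Rightarrow> int \<Rightarrow> 'a \<Rightarrow> real) \<Rightarrow> nat \<Rightarrow> int \<Rightarrow> 'a \<Rightarrow> real" where
  "v_full \<kappa> \<zeta> \<epsilon> n i \<omega> = (\<Sum>j = - \<kappa> - 1..int n + \<kappa> + 1. link \<kappa> \<zeta> \<epsilon> i j \<omega>)"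

definition g :: "(int \<Rightarrow> int \<Rightarrow> 'a \<Rightarrow> real) \<Rightarrow> int \<Rightarrow> int \<Rightarrow> 'a \<Rightarrow> real" where
  "g \<zeta> i j \<omega> = H (- \<bar>\<zeta> i j \<omega>\<bar>)"

definition gen_sigma :: "'a measure \<Rightarrow> 'i set \<Rightarrow> ('i \<Rightarrow> 'a \<Rightarrow> real) \<Rightarrow> 'a measure" where
  "gen_sigma M J X = sigma (space M) {X j -` A \<inter> space M | j A. j \<in> J \<and> A \<in> sets borel}"

text \<open>The argument \<open>s\<close> is the statistic generating the \<open>\<sigma>\<close>-field: \<open>s = v_trunc \<kappa> \<zeta> \<epsilon> n\<close> gives
  $\mathcal B^k_{i,n}$ and \<open>s = v_full \<kappa> \<zeta> \<epsilon> n\<close> gives $\mathcal B^k_i$.\<close>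

definition distant_sigma ::
  "'a measure \<Rightarrow> (int \<Rightarrow> int \<Rightarrow> 'a \<Rightarrow> real) \<Rightarrow> (int \<Rightarrow> 'a \<Rightarrow> real) \<Rightarrow> real \<Rightarrow> nat \<Rightarrow> int \<Rightarrow> 'a measure" where
  "distant_sigma M \<zeta> s k n i =
     gen_sigma M ({1..int n} - {i}) (\<lambda>j \<omega>. s j \<omega> * of_bool (g \<zeta> i j \<omega> \<le> Lam k))"

text \<open>A version of the conditional norm, determined almost everywhere only.\<close>

definition cond_norm2 ::
  "'a measure \<Rightarrow> (int \<Rightarrow> int \<Rightarrow> 'a \<Rightarrow> real) \<Rightarrow> ('a \<Rightarrow> real) \<Rightarrow> 'a \<Rightarrow> real" where
  "cond_norm2 M \<zeta> x \<omega> =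
     sqrt (real_cond_exp M (gen_sigma M pairs (\<lambda>(i, j). \<zeta> i j)) (\<lambda>\<omega>'. \<bar>x \<omega>'\<bar>\<^sup>2) \<omega>)"

text \<open>The normal law with mean \<open>m\<close> and variance \<open>s2\<close>, a point mass when \<open>s2 = 0\<close>.\<close>

definition normal_law :: "real \<Rightarrow> real \<Rightarrow> real measure" where
  "normal_law m s2 =
     (if s2 = 0 then return borel m else density lborel (normal_density m (sqrt s2)))"

end

(* Only links with |i - j| <= kappa can be present. Assigning the two directed links of an unordered
   pair to its smaller index writes the sum of the v_{i,n}, and that of the v_i, up to a bounded
   boundary term, as a sum of i.i.d. bounded blocks: Hoeffding's inequality with Borel-Cantelli gives
   the strong law, and the i.i.d. central limit theorem the normal limit. For (i), the statistic of
   agent i and the generators of its sigma-field are almost surely functions of disjoint families of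
   the independent noise variables. *)
theory Submission
  imports Defs
begin

text \<open>The rows of the network are not independent: d_ij and d_ji share the variable
  \<open>\<zeta> i j\<close>. For agents i and j this is the only shared variable, so the sums are
  regrouped by pairs instead of by rows. A block then sees no noise variable of another block, and
  its law does not depend on its position because the law of \<open>\<zeta> i j\<close> depends on
  the distance |i - j| alone. In (i) two rows may have a common neighbour l, yet the pairs {i, l}
  and {j, l} carry different variables. The one pair they could share is {i, j}, and it is outside
  both rows once |i - j| > \<kappa>. For k > \<kappa> the indicator in the generators switches off
  the closer agents, since there |\<open>\<zeta> i j\<close>| < k. These facts hold only almost
  surely, because the law of \<open>\<zeta> i j\<close> confines it to its interval only up to a
  null set. The statements on conditional expectation and on weak limits are therefore formulated up
  to null sets.\<close>

section \<open>Joint independence and conditioning on independent \<sigma>-fields\<close>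

lemma (in prob_space) indep_vars_Plus:
  assumes X: "indep_vars M1 X I" and Y: "indep_vars M2 Y J"
    and XY: "indep_var (PiM I M1) (\<lambda>\<omega>. \<lambda>i\<in>I. X i \<omega>) (PiM J M2) (\<lambda>\<omega>. \<lambda>j\<in>J. Y j \<omega>)"
  shows "indep_vars (case_sum M1 M2) (case_sum X Y) (I <+> J)"
  unfolding indep_vars_def2
proof (intro conjI ballI indep_setsI)
  have rvX: "random_variable (M1 i) (X i)" if "i \<in> I" for i
    using X that by (auto simp: indep_vars_def)
  have rvY: "random_variable (M2 j) (Y j)" if "j \<in> J" for j
    using Y that by (auto simp: indep_vars_def)
  show rv: "random_variable (case_sum M1 M2 i) (case_sum X Y i)" if "i \<in> I <+> J" for i
    using that rvX rvY by (auto split: sum.split)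
  show "{case_sum X Y i -` A \<inter> space M |A. A \<in> sets (case_sum M1 M2 i)} \<subseteq> events"
    if "i \<in> I <+> J" for i
    using rv[OF that] by (auto dest: measurable_sets)
  fix A K
  assume K: "K \<noteq> {}" "K \<subseteq> I <+> J" "finite K"
    and A: "\<forall>j\<in>K. A j \<in> {case_sum X Y j -` A \<inter> space M |A. A \<in> sets (case_sum M1 M2 j)}"
  from A obtain C where C: "\<And>j. j \<in> K \<Longrightarrow> A j = case_sum X Y j -` C j \<inter> space M"
      "\<And>j. j \<in> K \<Longrightarrow> C j \<in> sets (case_sum M1 M2 j)"
    by (simp add: image_iff) metis
  define K1 where "K1 = Inl -` K"
  define K2 where "K2 = Inr -` K"
  have fin: "finite K1" "finite K2"
    unfolding K1_def K2_def using K(3) by (auto intro!: finite_vimageI)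
  have sub: "K1 \<subseteq> I" "K2 \<subseteq> J" using K(2) by (auto simp: K1_def K2_def)
  have K_eq: "K = K1 <+> K2"
  proof (intro set_eqI iffI)
    fix x assume "x \<in> K" then show "x \<in> K1 <+> K2" by (cases x) (auto simp: K1_def K2_def)
  qed (auto simp: K1_def K2_def)
  have C1: "C (Inl i) \<in> sets (M1 i)" "A (Inl i) = X i -` C (Inl i) \<inter> space M" if "i \<in> K1" for i
    using C[of "Inl i"] that by (auto simp: K1_def)
  have C2: "C (Inr i) \<in> sets (M2 i)" "A (Inr i) = Y i -` C (Inr i) \<inter> space M" if "i \<in> K2" for i
    using C[of "Inr i"] that by (auto simp: K2_def)
  \<comment> \<open>Finitely many constraints on coordinates form a measurable cylinder, so the
    independence of the two whole families, a statement about product spaces, splits the probability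
    in two. Independence within each family then splits each factor.\<close>
  define E1 where "E1 = {x \<in> space (PiM I M1). \<forall>i\<in>K1. x i \<in> C (Inl i)}"
  define E2 where "E2 = {x \<in> space (PiM J M2). \<forall>i\<in>K2. x i \<in> C (Inr i)}"
  have E1: "E1 \<in> sets (PiM I M1)" unfolding E1_def
    by (intro sets.sets_Collect_finite_All fin(1) sets_Collect_single')
       (use sub C1 in auto)
  have E2: "E2 \<in> sets (PiM J M2)" unfolding E2_def
    by (intro sets.sets_Collect_finite_All fin(2) sets_Collect_single')
       (use sub C2 in auto)
  have v1: "(\<lambda>\<omega>. \<lambda>i\<in>I. X i \<omega>) -` E1 \<inter> space M = (\<Inter>j\<in>K1. A (Inl j)) \<inter> space M"
    using sub rvX[THEN measurable_space] by (auto simp: E1_def C1 space_PiM)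
  have v2: "(\<lambda>\<omega>. \<lambda>i\<in>J. Y i \<omega>) -` E2 \<inter> space M = (\<Inter>j\<in>K2. A (Inr j)) \<inter> space M"
    using sub rvY[THEN measurable_space] by (auto simp: E2_def C2 space_PiM)
  \<comment> \<open>\<open>K\<close> may lie entirely in one summand. The intersection over the
    other part is then \<open>UNIV\<close>, which is why it is cut down to
    \<open>space M\<close>.\<close>
  have p1: "prob ((\<Inter>j\<in>K1. A (Inl j)) \<inter> space M) = (\<Prod>j\<in>K1. prob (A (Inl j)))"
  proof (cases "K1 = {}")
    case False
    then have "(\<Inter>j\<in>K1. A (Inl j)) \<inter> space M = (\<Inter>j\<in>K1. X j -` C (Inl j) \<inter> space M)"
      by (auto simp: C1)
    with indep_varsD[OF X False fin(1) sub(1), of "\<lambda>i. C (Inl i)"] C1 show ?thesis by simp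
  qed (simp add: prob_space)
  have p2: "prob ((\<Inter>j\<in>K2. A (Inr j)) \<inter> space M) = (\<Prod>j\<in>K2. prob (A (Inr j)))"
  proof (cases "K2 = {}")
    case False
    then have "(\<Inter>j\<in>K2. A (Inr j)) \<inter> space M = (\<Inter>j\<in>K2. Y j -` C (Inr j) \<inter> space M)"
      by (auto simp: C2)
    with indep_varsD[OF Y False fin(2) sub(2), of "\<lambda>i. C (Inr i)"] C2 show ?thesis by simp
  qed (simp add: prob_space)
  have "(\<Inter>j\<in>K. A j) = (\<Inter>j\<in>K. A j) \<inter> space M"
    using K(1) C(1) by fastforce
  also have "\<dots> = ((\<Inter>j\<in>K1. A (Inl j)) \<inter> space M) \<inter> ((\<Inter>j\<in>K2. A (Inr j)) \<inter> space M)"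
    unfolding K_eq Plus_def by auto
  also have "\<dots> = (\<lambda>\<omega>. (\<lambda>i\<in>I. X i \<omega>, \<lambda>j\<in>J. Y j \<omega>)) -` (E1 \<times> E2) \<inter> space M"
    using v1 v2 by auto
  finally have "prob (\<Inter>j\<in>K. A j) =
      prob ((\<Inter>j\<in>K1. A (Inl j)) \<inter> space M) * prob ((\<Inter>j\<in>K2. A (Inr j)) \<inter> space M)"
    using indep_varD[OF XY E1 E2] v1 v2 by simp
  also have "\<dots> = (\<Prod>j\<in>K. prob (A j))"
    unfolding p1 p2 K_eq using fin by (simp add: prod.Plus)
  finally show "prob (\<Inter>j\<in>K. A j) = (\<Prod>j\<in>K. prob (A j))" .
qed

lemma sets_gen_sigma:
  "sets (gen_sigma M J X) =
    sigma_sets (space M) {X j -` A \<inter> space M | j A. j \<in> J \<and> A \<in> sets borel}"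
  unfolding gen_sigma_def by (rule sets_measure_of) auto

lemma (in prob_space) sigma_finite_subalgebra_gen_sigma:
  assumes "\<And>j. j \<in> J \<Longrightarrow> X j \<in> borel_measurable M"
  shows "sigma_finite_subalgebra M (gen_sigma M J X)"
proof -
  have "sigma_sets (space M) {X j -` A \<inter> space M | j A. j \<in> J \<and> A \<in> sets borel} \<subseteq> sets M"
    using assms by (intro sets.sigma_sets_subset) (auto dest: measurable_sets)
  then have "subalgebra M (gen_sigma M J X)"
    by (simp add: subalgebra_def sets_gen_sigma) (simp add: gen_sigma_def space_measure_of_conv)
  then show ?thesis
    by (intro finite_measure_subalgebra_is_sigma_finite) (unfold_locales, auto)
qed

text \<open>Up to null sets, every event of the generated \<sigma>-field is a preimage under
  \<open>W\<close>, so its indicator is independent of \<open>f\<close> and the integral of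
  \<open>f\<close> over it factorises. Equality almost everywhere is the right hypothesis here:
  truncating a row to its near neighbours changes it on a null set, and this may change the
  generated \<sigma>-field itself.\<close>

lemma (in prob_space) real_cond_exp_gen_sigma_indep:
  fixes f :: "'a \<Rightarrow> real"
  assumes indep: "indep_var N1 U N2 W"
    and f: "integrable M f" "AE \<omega> in M. f \<omega> = \<phi> (U \<omega>)" and phi: "\<phi> \<in> borel_measurable N1"
    and X: "\<And>j. j \<in> J \<Longrightarrow> X j \<in> borel_measurable M"
      "\<And>j. j \<in> J \<Longrightarrow> AE \<omega> in M. X j \<omega> = \<psi> j (W \<omega>)"
    and psi: "\<And>j. j \<in> J \<Longrightarrow> \<psi> j \<in> borel_measurable N2"
  shows "AE \<omega> in M. real_cond_exp M (gen_sigma M J X) f \<omega> = expectation f"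
proof -
  interpret G: sigma_finite_subalgebra M "gen_sigma M J X"
    using X(1) by (rule sigma_finite_subalgebra_gen_sigma)
  note W = indep_var_rv2[OF indep] and U = indep_var_rv1[OF indep]
  note [measurable] = f(1)[THEN borel_measurable_integrable] phi U W
  \<comment> \<open>The sets with this property contain the generators and are closed under
    complement and countable union, since countably many null sets have a null union.\<close>
  have approx: "\<exists>C\<in>sets N2. AE \<omega> in M. \<omega> \<in> A \<longleftrightarrow> W \<omega> \<in> C" if "A \<in> sets (gen_sigma M J X)" for A
    using that unfolding sets_gen_sigma
  proof (induction rule: sigma_sets.induct)
    case (Basic a)
    then obtain j A where a: "a = X j -` A \<inter> space M" "j \<in> J" "A \<in> sets borel" by blast
    have "\<psi> j -` A \<inter> space N2 \<in> sets N2" using psi[OF a(2)] a(3) by (rule measurable_sets)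
    moreover have "AE \<omega> in M. \<omega> \<in> a \<longleftrightarrow> W \<omega> \<in> \<psi> j -` A \<inter> space N2"
      using X(2)[OF a(2)] AE_space by eventually_elim (use measurable_space[OF W] a in auto)
    ultimately show ?case by blast
  next
    case Empty
    then show ?case by (intro bexI[of _ "{}"]) auto
  next
    case (Compl a)
    then obtain C where C: "C \<in> sets N2" "AE \<omega> in M. \<omega> \<in> a \<longleftrightarrow> W \<omega> \<in> C" by blast
    have "AE \<omega> in M. \<omega> \<in> space M - a \<longleftrightarrow> W \<omega> \<in> space N2 - C"
      using C(2) AE_space by eventually_elim (use measurable_space[OF W] in auto)
    then show ?case using C(1) by blast
  next
    case (Union a)
    then obtain C where C: "\<And>i::nat. C i \<in> sets N2" "\<And>i. AE \<omega> in M. \<omega> \<in> a i \<longleftrightarrow> W \<omega> \<in> C i"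
      by metis
    have "AE \<omega> in M. \<forall>i. \<omega> \<in> a i \<longleftrightarrow> W \<omega> \<in> C i" using C(2) by (simp add: AE_all_countable)
    then have "AE \<omega> in M. \<omega> \<in> \<Union>(range a) \<longleftrightarrow> W \<omega> \<in> \<Union>(range C)"
      by eventually_elim auto
    then show ?case using C(1) by blast
  qed
  have phiU: "integrable M (\<lambda>\<omega>. \<phi> (U \<omega>))"
    using f by (subst integrable_cong_AE[symmetric]) auto
  have Ef: "expectation f = expectation (\<lambda>\<omega>. \<phi> (U \<omega>))"
    using f(2) by (intro integral_cong_AE) auto
  show ?thesis
  proof (rule G.real_cond_exp_charact)
    fix A assume A: "A \<in> sets (gen_sigma M J X)"
    then have [measurable]: "A \<in> events" using G.subalg by (auto simp: subalgebra_def)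
    obtain C where [measurable]: "C \<in> sets N2" and AC: "AE \<omega> in M. \<omega> \<in> A \<longleftrightarrow> W \<omega> \<in> C"
      using approx[OF A] by blast
    have ind: "indep_var borel (\<phi> \<circ> U) borel ((indicator C :: _ \<Rightarrow> real) \<circ> W)"
      using indep by (rule indep_var_compose) simp_all
    have "(\<integral>\<omega>\<in>A. f \<omega> \<partial>M) = expectation (\<lambda>\<omega>. \<phi> (U \<omega>) * indicator C (W \<omega>))"
      unfolding set_lebesgue_integral_def
      by (intro integral_cong_AE, measurable)
         (use f(2) AC in \<open>eventually_elim, auto split: split_indicator\<close>)
    also have "\<dots> = expectation f * expectation (\<lambda>\<omega>. indicator C (W \<omega>))"
      using indep_var_lebesgue_integral[OF ind] phiU
      by (simp add: comp_def Ef integrable_const_bound[where B = 1])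
    also have "expectation (\<lambda>\<omega>. indicator C (W \<omega>)) = expectation (indicator A)"
      by (intro integral_cong_AE, measurable)
         (use AC in \<open>eventually_elim, auto split: split_indicator\<close>)
    also have "expectation f * \<dots> = (\<integral>\<omega>\<in>A. expectation f \<partial>M)"
      by (simp add: set_lebesgue_integral_def)
    finally show "(\<integral>\<omega>\<in>A. f \<omega> \<partial>M) = (\<integral>\<omega>\<in>A. expectation f \<partial>M)" .
  qed (use f in auto)
qed

section \<open>Weak convergence: small perturbations and the degenerate normal law\<close>

text \<open>The error bound is deterministic, so the characteristic functions at \<open>t\<close>
  differ by at most \<open>\<bar>t\<bar> * c n\<close>, and Levy's theorem carries the limit over.
  This absorbs the boundary terms of the network.\<close>

lemma (in prob_space) weak_conv_m_AE_close:
  fixes X Y :: "nat \<Rightarrow> 'a \<Rightarrow> real"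
  assumes [measurable]: "\<And>n. X n \<in> borel_measurable M" "\<And>n. Y n \<in> borel_measurable M"
    and close: "\<And>n. AE \<omega> in M. \<bar>X n \<omega> - Y n \<omega>\<bar> \<le> c n" and c: "c \<longlonglongrightarrow> 0"
    and L: "real_distribution L" and conv: "weak_conv_m (\<lambda>n. distr M borel (X n)) L"
  shows "weak_conv_m (\<lambda>n. distr M borel (Y n)) L"
proof (rule levy_continuity)
  show rd: "real_distribution (distr M borel (Y n))" for n by (rule real_distribution_distr) simp
  show "real_distribution L" by fact
  fix t
  have charX: "(\<lambda>n. char (distr M borel (X n)) t) \<longlonglongrightarrow> char L t"
    using _ L conv by (rule levy_continuity1) (rule real_distribution_distr, simp)
  have int: "integrable M (\<lambda>\<omega>. iexp (t * Z \<omega>))" if "Z \<in> borel_measurable M" for Z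
    using that by (intro integrable_const_bound[where B = 1]) auto
  have bound: "norm (char (distr M borel (Y n)) t - char (distr M borel (X n)) t) \<le> \<bar>t\<bar> * c n" for n
  proof -
    \<comment> \<open>Taking out a factor of modulus 1 leaves the elementary estimate of
      \<open>iexp x - 1\<close> by \<open>\<bar>x\<bar>\<close>.\<close>
    have eq: "iexp (t * Y n \<omega>) - iexp (t * X n \<omega>) =
        iexp (t * X n \<omega>) * (iexp (t * (Y n \<omega> - X n \<omega>)) - 1)" for \<omega>
      by (simp add: algebra_simps flip: exp_add)
    have le: "norm (iexp (t * Y n \<omega>) - iexp (t * X n \<omega>)) \<le> \<bar>t\<bar> * \<bar>Y n \<omega> - X n \<omega>\<bar>" for \<omega>
    proof -
      have "norm (iexp (t * Y n \<omega>) - iexp (t * X n \<omega>)) = norm (iexp (t * (Y n \<omega> - X n \<omega>)) - 1)"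
        unfolding eq norm_mult by simp
      also have "\<dots> \<le> \<bar>t * (Y n \<omega> - X n \<omega>)\<bar>"
        using iexp_approx1[of "t * (Y n \<omega> - X n \<omega>)" 0] by simp
      finally show ?thesis by (simp add: abs_mult)
    qed
    have "norm (char (distr M borel (Y n)) t - char (distr M borel (X n)) t) =
        norm (\<integral>\<omega>. iexp (t * Y n \<omega>) - iexp (t * X n \<omega>) \<partial>M)"
      using Bochner_Integration.integral_diff[OF int[of "Y n"] int[of "X n"]]
      by (simp add: char_def integral_distr)
    also have "\<dots> \<le> (\<integral>\<omega>. norm (iexp (t * Y n \<omega>) - iexp (t * X n \<omega>)) \<partial>M)"
      by (rule integral_norm_bound)
    also have "\<dots> \<le> (\<integral>\<omega>. \<bar>t\<bar> * c n \<partial>M)"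
    proof (rule integral_mono_AE)
      show "integrable M (\<lambda>\<omega>. norm (iexp (t * Y n \<omega>) - iexp (t * X n \<omega>)))"
        by (intro integrable_norm Bochner_Integration.integrable_diff int) simp_all
      show "AE \<omega> in M. norm (iexp (t * Y n \<omega>) - iexp (t * X n \<omega>)) \<le> \<bar>t\<bar> * c n"
        using close[of n]
      proof eventually_elim
        case (elim \<omega>)
        have "\<bar>t\<bar> * \<bar>Y n \<omega> - X n \<omega>\<bar> \<le> \<bar>t\<bar> * c n"
          using elim by (intro mult_left_mono) (auto simp: abs_minus_commute)
        with le[of \<omega>] show ?case by simp
      qed
    qed simp
    finally show ?thesis by (simp add: prob_space)
  qed
  have "(\<lambda>n. char (distr M borel (Y n)) t - char (distr M borel (X n)) t) \<longlonglongrightarrow> 0"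
  proof (rule Lim_null_comparison)
    show "(\<lambda>n. \<bar>t\<bar> * c n) \<longlonglongrightarrow> 0" using tendsto_mult_right_zero[OF c] .
    show "\<forall>\<^sub>F n in sequentially.
        norm (char (distr M borel (Y n)) t - char (distr M borel (X n)) t) \<le> \<bar>t\<bar> * c n"
      using bound by simp
  qed
  from tendsto_add[OF this charX] show "(\<lambda>n. char (distr M borel (Y n)) t) \<longlonglongrightarrow> char L t" by simp
qed

lemma real_distribution_normal_law:
  assumes "0 \<le> s2"
  shows "real_distribution (normal_law m s2)"
proof (cases "s2 = 0")
  case True
  then show ?thesis
    by (auto simp: normal_law_def real_distribution_def real_distribution_axioms_def
        intro!: prob_space_return)
next
  case False
  then show ?thesis using assms prob_space_normal_density[of "sqrt s2" m]
    by (auto simp: normal_law_def real_distribution_def real_distribution_axioms_def)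
qed

lemma char_distr_cmult:
  assumes "X \<in> borel_measurable M"
  shows "char (distr M borel (\<lambda>\<omega>. c * X \<omega>)) t = char (distr M borel X) (c * t)"
  using assms unfolding char_def by (simp add: integral_distr mult_ac)

lemma char_normal_law:
  assumes "0 < s"
  shows "char (normal_law 0 (s\<^sup>2)) t = char std_normal_distribution (s * t)"
proof -
  interpret prob_space std_normal_distribution by (rule prob_space_normal_density) simp
  have "distributed std_normal_distribution lborel (\<lambda>x. x) (normal_density 0 1)"
    by (simp add: distributed_def distr_id2)
  from normal_density_affine[OF this, of s 0] assms
  have "distributed std_normal_distribution lborel (\<lambda>x. s * x) (normal_density 0 s)" by simp
  then have "normal_law 0 (s\<^sup>2) = distr std_normal_distribution lborel (\<lambda>x. s * x)"
    using assms by (simp add: normal_law_def distributed_def)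
  also have "\<dots> = distr std_normal_distribution borel (\<lambda>x. s * x)"
    by (rule distr_cong) auto
  finally show ?thesis
    unfolding char_def by (simp add: integral_distr mult_ac)
qed

text \<open>The normalisation is by \<open>sqrt (real n)\<close> alone, so the variance may be 0. In
  that case each variable equals its mean almost surely, and the laws are the point mass at 0 for
  every n. Otherwise the standardised theorem is rescaled.\<close>

lemma (in prob_space) central_limit_normal_law:
  fixes X :: "nat \<Rightarrow> 'a \<Rightarrow> real"
  assumes indep: "indep_vars (\<lambda>_. borel) X UNIV"
    and distr: "\<And>k. distr M borel (X k) = distr M borel (X 0)"
    and sq: "integrable M (\<lambda>\<omega>. (X 0 \<omega>)\<^sup>2)"
  shows "weak_conv_m (\<lambda>n. distr M borel (\<lambda>\<omega>. (\<Sum>k<n. X k \<omega> - expectation (X 0)) / sqrt (real n)))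
    (normal_law 0 (variance (X 0)))"
proof -
  have [measurable]: "X k \<in> borel_measurable M" for k
    using indep by (auto simp: indep_vars_def)
  have E: "expectation (\<lambda>\<omega>. h (X k \<omega>)) = expectation (\<lambda>\<omega>. h (X 0 \<omega>))"
    if [measurable]: "h \<in> borel_measurable borel" for k and h :: "real \<Rightarrow> real"
  proof -
    have "expectation (\<lambda>\<omega>. h (X k \<omega>)) = integral\<^sup>L (distr M borel (X k)) h"
      by (simp add: integral_distr)
    also have "\<dots> = integral\<^sup>L (distr M borel (X 0)) h" by (simp only: distr[of k])
    also have "\<dots> = expectation (\<lambda>\<omega>. h (X 0 \<omega>))" by (simp add: integral_distr)
    finally show ?thesis .
  qed
  have sqk: "integrable M (\<lambda>\<omega>. (X k \<omega>)\<^sup>2)" for k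
  proof -
    have "integrable (distr M borel (X 0)) (\<lambda>x. x\<^sup>2)" using sq by (simp add: integrable_distr_eq)
    then have "integrable (distr M borel (X k)) (\<lambda>x. x\<^sup>2)" by (simp only: distr[of k])
    then show ?thesis by (simp add: integrable_distr_eq)
  qed
  have Ek: "expectation (X k) = expectation (X 0)" for k using E[of "\<lambda>x. x" k] by simp
  have Vk: "variance (X k) = variance (X 0)" for k
    using E[of "\<lambda>x. (x - expectation (X 0))\<^sup>2" k] by (simp add: Ek[of k])
  let ?S = "\<lambda>n \<omega>. \<Sum>k<n. X k \<omega> - expectation (X 0)"
  have V0: "0 \<le> variance (X 0)" by (rule variance_positive)
  show ?thesis
  proof (cases "variance (X 0) = 0")
    case True
    have intk: "integrable M (\<lambda>\<omega>. (X k \<omega> - expectation (X 0))\<^sup>2)" for k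
    proof -
      have "integrable M (X k)" by (rule square_integrable_imp_integrable[OF _ sqk]) simp
      with sqk[of k] show ?thesis by (simp add: power2_diff)
    qed
    have "AE \<omega> in M. X k \<omega> = expectation (X 0)" for k
    proof -
      have "AE \<omega> in M. (X k \<omega> - expectation (X 0))\<^sup>2 = 0"
        using Vk[of k] True intk[of k] unfolding Ek[of k]
        by (subst integral_nonneg_eq_0_iff_AE[symmetric]) auto
      then show ?thesis by simp
    qed
    then have all: "AE \<omega> in M. \<forall>k. X k \<omega> = expectation (X 0)" by (simp add: AE_all_countable)
    have "distr M borel (\<lambda>\<omega>. ?S n \<omega> / sqrt (real n)) = distr M borel (\<lambda>_. 0)" for n
      by (rule distr_cong_AE) (use all in \<open>auto elim!: eventually_mono\<close>)
    also have "distr M borel (\<lambda>_. 0 :: real) = return borel 0" by simp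
    finally show ?thesis using True by (simp add: normal_law_def weak_conv_m_def weak_conv_def)
  next
    case False
    define s where "s = sqrt (variance (X 0))"
    have "0 < variance (X 0)" using False V0 by linarith
    then have s: "0 < s" "variance (X 0) = s\<^sup>2" by (simp_all add: s_def)
    have clt: "weak_conv_m (\<lambda>n. distr M borel (\<lambda>\<omega>. ?S n \<omega> / sqrt (real n * s\<^sup>2))) std_normal_distribution"
      by (rule central_limit_theorem[OF indep Ek s(1) sqk trans[OF Vk s(2)] distr])
    have "weak_conv_m (\<lambda>n. distr M borel (\<lambda>\<omega>. ?S n \<omega> / sqrt (real n))) (normal_law 0 (s\<^sup>2))"
    proof (rule levy_continuity)
      show "real_distribution (distr M borel (\<lambda>\<omega>. ?S n \<omega> / sqrt (real n)))" for n
        by (rule real_distribution_distr) simp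
      show "real_distribution (normal_law 0 (s\<^sup>2))" by (simp add: real_distribution_normal_law)
      fix t
      \<comment> \<open>Evaluating at \<open>s * t\<close> undoes the division by the standard
        deviation \<open>s\<close>, on the side of the sums as well as in the limit.\<close>
      have "(\<lambda>n. char (distr M borel (\<lambda>\<omega>. ?S n \<omega> / sqrt (real n * s\<^sup>2))) (s * t))
          \<longlonglongrightarrow> char std_normal_distribution (s * t)"
        by (rule levy_continuity1[OF _ _ clt])
          (auto intro!: real_distribution_distr real_dist_normal_dist)
      moreover have "char (distr M borel (\<lambda>\<omega>. ?S n \<omega> / sqrt (real n * s\<^sup>2))) (s * t) =
          char (distr M borel (\<lambda>\<omega>. ?S n \<omega> / sqrt (real n))) t" for n
        using s(1) by (subst char_distr_cmult[symmetric]) (simp_all add: real_sqrt_mult)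
      ultimately show "(\<lambda>n. char (distr M borel (\<lambda>\<omega>. ?S n \<omega> / sqrt (real n))) t)
          \<longlonglongrightarrow> char (normal_law 0 (s\<^sup>2)) t"
        using s(1) by (simp add: char_normal_law)
    qed
    then show ?thesis using s(2) by simp
  qed
qed

section \<open>Strong law for bounded independent variables\<close>

lemma (in prob_space) strong_law_bounded:
  fixes X :: "nat \<Rightarrow> 'a \<Rightarrow> real"
  assumes indep: "indep_vars (\<lambda>_. borel) X UNIV"
    and bdd: "\<And>k \<omega>. \<bar>X k \<omega>\<bar> \<le> B"
    and mean: "\<And>k. expectation (X k) = m"
  shows "AE \<omega> in M. (\<lambda>n. (\<Sum>k<n. X k \<omega>) / real n) \<longlonglongrightarrow> m"
proof -
  have [measurable]: "X k \<in> borel_measurable M" for k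
    using indep by (auto simp: indep_vars_def)
  \<comment> \<open>Adding 1 makes the half-width of the range positive even if \<open>B\<close> is
    0; the exponents below divide by it.\<close>
  define b where "b = \<bar>B\<bar> + 1"
  have b: "0 < b" "\<And>k \<omega>. \<bar>X k \<omega>\<bar> \<le> b"
    unfolding b_def using bdd by (auto intro: order_trans[OF bdd])
  have dev: "AE \<omega> in M. eventually (\<lambda>n. \<bar>(\<Sum>k<n. X k \<omega>) / real n - m\<bar> < d) sequentially"
    if d: "0 < d" for d
  proof -
    \<comment> \<open>With n intervals of length 2b, Hoeffding's exponent 2(nd)^2 / (n(2b)^2) is
      linear in n, so the tail is geometric with ratio \<open>q\<close>.\<close>
    define q where "q = exp (- (d\<^sup>2 / (2 * b\<^sup>2)))"
    have q: "0 \<le> q" "q < 1" using d b by (auto simp: q_def)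
    let ?A = "\<lambda>n. {\<omega> \<in> space M. \<bar>(\<Sum>k<n. X k \<omega>) - real n * m\<bar> \<ge> real n * d}"
    have prob_le: "prob (?A n) \<le> 2 * q ^ n" if n: "1 \<le> n" for n
    proof -
      interpret Hoeffding_ineq M "{..<n}" X "\<lambda>_. - b" "\<lambda>_. b" "\<Sum>k<n. expectation (X k)"
      proof unfold_locales
        show "AE \<omega> in M. X i \<omega> \<in> {- b..b}" for i
          using b(2)[of i] by (auto simp: abs_le_iff minus_le_iff)
      qed (auto intro: indep_vars_subset[OF indep])
      have "prob (?A n) \<le> 2 * exp (- 2 * (real n * d)\<^sup>2 / (\<Sum>i\<in>{..<n}. (b - - b)\<^sup>2))"
        using Hoeffding_ineq_abs_ge[of "real n * d"] n d b(1) by (simp add: mean)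
      also have "- 2 * (real n * d)\<^sup>2 / (\<Sum>i\<in>{..<n}. (b - - b)\<^sup>2) = real n * (- (d\<^sup>2 / (2 * b\<^sup>2)))"
        using n b(1) by (simp add: field_simps power2_eq_square)
      also have "exp \<dots> = q ^ n" unfolding q_def by (rule exp_of_nat_mult)
      finally show ?thesis .
    qed
    have "summable (\<lambda>n. prob (?A n))"
    proof (rule summable_comparison_test')
      show "summable (\<lambda>n. 2 * q ^ n)" using q by (intro summable_mult summable_geometric) auto
      show "norm (prob (?A n)) \<le> 2 * q ^ n" if "1 \<le> n" for n using prob_le[OF that] by simp
    qed
    then have "AE \<omega> in M. eventually (\<lambda>n. \<omega> \<in> space M - ?A n) sequentially"
      by (intro borel_cantelli_AE1) (auto simp: less_top[symmetric])
    then show ?thesis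
    proof eventually_elim
      case (elim \<omega>)
      show ?case using elim eventually_ge_at_top[of 1]
      proof eventually_elim
        case (elim n)
        then have "\<bar>(\<Sum>k<n. X k \<omega>) - real n * m\<bar> < real n * d" by auto
        moreover have "(\<Sum>k<n. X k \<omega>) / real n - m = ((\<Sum>k<n. X k \<omega>) - real n * m) / real n"
          using elim by (simp add: field_simps)
        ultimately show ?case using elim by (simp add: field_simps)
      qed
    qed
  qed
  \<comment> \<open>The exceptional null set depends on the tolerance; countably many tolerances
    suffice for convergence.\<close>
  have "AE \<omega> in M. \<forall>j. eventually (\<lambda>n. \<bar>(\<Sum>k<n. X k \<omega>) / real n - m\<bar> < inverse (real (Suc j))) sequentially"
    unfolding AE_all_countable using dev by simp
  then show ?thesis
  proof eventually_elim
    case (elim \<omega>)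
    show ?case
    proof (rule tendstoI)
      fix e :: real assume "0 < e"
      then obtain j where j: "inverse (real (Suc j)) < e" using reals_Archimedean by blast
      show "\<forall>\<^sub>F n in sequentially. dist ((\<Sum>k<n. X k \<omega>) / real n) m < e"
        using elim[rule_format, of j] by eventually_elim (use j in \<open>auto simp: dist_real_def\<close>)
    qed
  qed
qed

section \<open>Links as functions of an independent noise family\<close>

lemma H_less_iff: "H x < H y \<longleftrightarrow> x < y"
proof -
  have pos: "0 < 1 + exp x" "0 < 1 + exp y" by (simp_all add: add_pos_pos)
  have "H x < H y \<longleftrightarrow> exp x * (1 + exp y) < exp y * (1 + exp x)"
    unfolding H_def using pos by (simp add: frac_less_eq divide_less_eq less_divide_eq field_simps)
  then show ?thesis by (simp add: algebra_simps)
qed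

text \<open>\<open>H\<close> is strictly increasing. With
  \<open>a = \<bar>\<zeta> i j \<omega>\<bar>\<close>, the indicator in the generators becomes a
  lower bound on the distance variable.\<close>

lemma H_le_Lam_iff: "H (- a) \<le> Lam k \<longleftrightarrow> k \<le> a"
  using H_less_iff[of "- k" "- a"] by (auto simp: Lam_def not_less[symmetric])

definition link_fun :: "int \<Rightarrow> real \<Rightarrow> real \<Rightarrow> real" where
  "link_fun \<kappa> z e = (if 0 < - \<bar>z\<bar> + e \<and> \<bar>z\<bar> < real_of_int \<kappa> then 1 else 0)"

lemma measurable_link_fun [measurable (raw)]:
  assumes [measurable]: "f \<in> borel_measurable N" "h \<in> borel_measurable N"
  shows "(\<lambda>x. link_fun \<kappa> (f x) (h x)) \<in> borel_measurable N"
  unfolding link_fun_def by measurable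

lemma link_eq: "link \<kappa> \<zeta> \<epsilon> i j \<omega> = (if i = j then 0 else link_fun \<kappa> (\<zeta> i j \<omega>) (\<epsilon> i j \<omega>))"
  by (simp add: link_def link_fun_def)

lemma link_self: "link \<kappa> \<zeta> \<epsilon> i i \<omega> = 0"
  by (simp add: link_def)

lemma link_bounds: "0 \<le> link \<kappa> \<zeta> \<epsilon> i j \<omega>" "link \<kappa> \<zeta> \<epsilon> i j \<omega> \<le> 1"
  by (simp_all add: link_def)

text \<open>The representative in \<open>unordered_pairs\<close> of the potential link between \<open>i\<close> and \<open>j\<close>.\<close>

definition up :: "int \<Rightarrow> int \<Rightarrow> int \<times> int" where
  "up i j = (if 1 \<le> j \<and> j < i then (j, i) else (i, j))"

text \<open>At most the order is forgotten. Hence the rows of two different agents can meet in a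
  \<open>\<zeta>\<close> variable only at the pair formed by these agents.\<close>

lemma up_eqD: "up i j = up i' j' \<Longrightarrow> i = i' \<and> j = j' \<or> i = j' \<and> j = i'"
  by (auto simp: up_def split: if_splits)

definition noise :: "(int \<Rightarrow> int \<Rightarrow> 'a \<Rightarrow> real) \<Rightarrow> (int \<Rightarrow> int \<Rightarrow> 'a \<Rightarrow> real) \<Rightarrow>
    (int \<times> int) + (int \<times> int) \<Rightarrow> 'a \<Rightarrow> real" where
  "noise \<zeta> \<epsilon> = case_sum (\<lambda>(i, j). \<zeta> i j) (\<lambda>(i, j). \<epsilon> i j)"

text \<open>The symmetric variables enter once per unordered pair, since two equal copies would
  destroy independence; the directed variables enter once per ordered pair.\<close>

abbreviation noise_index :: "((int \<times> int) + (int \<times> int)) set" where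
  "noise_index \<equiv> unordered_pairs <+> pairs"

definition row_index :: "int \<Rightarrow> int set \<Rightarrow> ((int \<times> int) + (int \<times> int)) set" where
  "row_index i R = (\<lambda>j. Inl (up i j)) ` R \<union> (\<lambda>j. Inr (i, j)) ` R"

definition row_fun :: "int \<Rightarrow> int set \<Rightarrow> int \<Rightarrow> ((int \<times> int) + (int \<times> int) \<Rightarrow> real) \<Rightarrow> real" where
  "row_fun \<kappa> R i x = (\<Sum>j\<in>R - {i}. link_fun \<kappa> (x (Inl (up i j))) (x (Inr (i, j))))"

lemma measurable_row_fun:
  assumes "row_index i R \<subseteq> T"
  shows "row_fun \<kappa> R i \<in> borel_measurable (PiM T (\<lambda>_. borel))"
  unfolding row_fun_def
proof (intro borel_measurable_sum measurable_link_fun)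
  fix j assume "j \<in> R - {i}"
  then have "Inl (up i j) \<in> T" "Inr (i, j) \<in> T" using assms by (auto simp: row_index_def)
  then show "(\<lambda>x. x (Inl (up i j))) \<in> borel_measurable (PiM T (\<lambda>_. borel))"
    "(\<lambda>x. x (Inr (i, j))) \<in> borel_measurable (PiM T (\<lambda>_. borel))"
    by (auto intro!: measurable_component_singleton)
qed

text \<open>The block of an agent placed at 0. \<open>shift_index\<close> moves it to its true
  position, so that every block is the same function \<open>block_fun\<close> of a translated noise
  family. One \<open>\<zeta>\<close> variable serves both directed links of a pair.\<close>

definition block_index :: "int \<Rightarrow> ((int \<times> int) + (int \<times> int)) set" where
  "block_index \<kappa> =
     (\<lambda>m. Inl (0, m)) ` {1..\<kappa>} \<union> (\<lambda>m. Inr (0, m)) ` {1..\<kappa>} \<union> (\<lambda>m. Inr (m, 0)) ` {1..\<kappa>}"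

definition block_fun :: "int \<Rightarrow> ((int \<times> int) + (int \<times> int) \<Rightarrow> real) \<Rightarrow> real" where
  "block_fun \<kappa> x = (\<Sum>m = 1..\<kappa>. link_fun \<kappa> (x (Inl (0, m))) (x (Inr (0, m))) +
     link_fun \<kappa> (x (Inl (0, m))) (x (Inr (m, 0))))"

definition shift_index :: "int \<Rightarrow> (int \<times> int) + (int \<times> int) \<Rightarrow> (int \<times> int) + (int \<times> int)" where
  "shift_index i = map_sum (\<lambda>(a, b). (a + i, b + i)) (\<lambda>(a, b). (a + i, b + i))"

definition block_sum ::
  "int \<Rightarrow> (int \<Rightarrow> int \<Rightarrow> 'a \<Rightarrow> real) \<Rightarrow> (int \<Rightarrow> int \<Rightarrow> 'a \<Rightarrow> real) \<Rightarrow> int \<Rightarrow> 'a \<Rightarrow> real" where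
  "block_sum \<kappa> \<zeta> \<epsilon> i \<omega> =
     (\<Sum>m = 1..\<kappa>. link \<kappa> \<zeta> \<epsilon> i (i + m) \<omega> + link \<kappa> \<zeta> \<epsilon> (i + m) i \<omega>)"

lemma measurable_block_fun: "block_fun \<kappa> \<in> borel_measurable (PiM (block_index \<kappa>) (\<lambda>_. borel))"
  unfolding block_fun_def block_index_def
  by (intro borel_measurable_sum borel_measurable_add measurable_link_fun
      measurable_component_singleton) auto

lemma block_sum_bounds: "\<bar>block_sum \<kappa> \<zeta> \<epsilon> i \<omega>\<bar> \<le> 2 * real (nat \<kappa>)"
proof -
  have "0 \<le> block_sum \<kappa> \<zeta> \<epsilon> i \<omega>"
    unfolding block_sum_def by (intro sum_nonneg add_nonneg_nonneg link_bounds)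
  moreover have "block_sum \<kappa> \<zeta> \<epsilon> i \<omega> \<le> (\<Sum>m = 1..\<kappa>. 1 + 1)"
    unfolding block_sum_def by (intro sum_mono add_mono link_bounds)
  ultimately show ?thesis by simp
qed

section \<open>Counting the links at the boundary\<close>

lemma abs_sum_diff_le_card:
  fixes f :: "'b \<Rightarrow> real"
  assumes fin: "finite A" "finite C" "finite E"
    and f: "\<And>p. 0 \<le> f p" "\<And>p. f p \<le> 1"
    and E: "\<And>p. p \<in> (A - C) \<union> (C - A) \<Longrightarrow> f p \<noteq> 0 \<Longrightarrow> p \<in> E"
  shows "\<bar>sum f A - sum f C\<bar> \<le> card E"
proof -
  have "sum f A = sum f (A \<inter> C) + sum f (A - C)" "sum f C = sum f (A \<inter> C) + sum f (C - A)"
    using sum.Int_Diff[OF fin(1), of f C] sum.Int_Diff[OF fin(2), of f A] by (simp_all add: Int_commute)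
  moreover have "0 \<le> sum f (A - C)" "0 \<le> sum f (C - A)" by (auto intro: sum_nonneg f)
  ultimately have "\<bar>sum f A - sum f C\<bar> \<le> sum f (A - C) + sum f (C - A)" by linarith
  also have "\<dots> = sum f ((A - C) \<union> (C - A))"
    using fin by (subst sum.union_disjoint) auto
  also have "\<dots> = sum f ({p \<in> (A - C) \<union> (C - A). f p \<noteq> 0})"
    using fin by (intro sum.mono_neutral_right) auto
  also have "\<dots> \<le> sum f E" using E fin f by (intro sum_mono2) auto
  also have "\<dots> \<le> (\<Sum>p\<in>E. 1)" by (intro sum_mono f)
  finally show ?thesis by simp
qed

text \<open>Putting j = i + m sends the outgoing links to the pairs above the diagonal and the
  incoming ones to their mirror image; the two halves are disjoint, and \<open>C\<close> is their
  union.\<close>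

lemma block_double_sum:
  fixes L :: "int \<Rightarrow> int \<Rightarrow> real" and N \<kappa> :: int
  defines "C \<equiv> {(i, j). (1 \<le> i \<and> i \<le> N \<and> i < j \<and> j \<le> i + \<kappa>) \<or> (1 \<le> j \<and> j \<le> N \<and> j < i \<and> i \<le> j + \<kappa>)}"
  shows "finite C" "(\<Sum>i = 1..N. \<Sum>m = 1..\<kappa>. L i (i + m) + L (i + m) i) = (\<Sum>(i, j)\<in>C. L i j)"
proof -
  let ?C1 = "Sigma {1..N} (\<lambda>i. {i + 1..i + \<kappa>})"
  have C: "C = ?C1 \<union> prod.swap ` ?C1" unfolding C_def by (auto simp: image_iff)
  show "finite C" unfolding C by auto
  have row: "(\<Sum>m = 1..\<kappa>. h (i + m)) = sum h {i + 1..i + \<kappa>}" for i and h :: "int \<Rightarrow> real"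
    by (rule sum.reindex_bij_witness[of _ "\<lambda>j. j - i" "\<lambda>m. i + m"]) auto
  have "(\<Sum>i = 1..N. \<Sum>m = 1..\<kappa>. L i (i + m) + L (i + m) i) =
      (\<Sum>i = 1..N. \<Sum>j\<in>{i + 1..i + \<kappa>}. L i j) + (\<Sum>i = 1..N. \<Sum>j\<in>{i + 1..i + \<kappa>}. L j i)"
    using row[of "L _"] row[of "\<lambda>j. L j _"] by (simp add: sum.distrib)
  also have "\<dots> = (\<Sum>(i, j)\<in>?C1. L i j) + (\<Sum>(i, j)\<in>?C1. L j i)"
    by (simp add: sum.Sigma)
  also have "(\<Sum>(i, j)\<in>?C1. L j i) = (\<Sum>(i, j)\<in>prod.swap ` ?C1. L i j)"
    by (subst sum.reindex) (auto simp: case_prod_beta)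
  also have "(\<Sum>(i, j)\<in>?C1. L i j) + \<dots> = (\<Sum>(i, j)\<in>C. L i j)"
    unfolding C by (subst sum.union_disjoint) auto
  finally show "(\<Sum>i = 1..N. \<Sum>m = 1..\<kappa>. L i (i + m) + L (i + m) i) = (\<Sum>(i, j)\<in>C. L i j)" .
qed

text \<open>The two alternatives for \<open>a\<close> and \<open>b\<close> are the summation ranges of \<open>v_trunc\<close> and \<open>v_full\<close>.\<close>

lemma banded_sum_boundary:
  fixes L :: "int \<Rightarrow> int \<Rightarrow> real"
  assumes kappa: "0 \<le> \<kappa>"
    and L: "\<And>i j. 0 \<le> L i j" "\<And>i j. L i j \<le> 1"
    and zero: "\<And>i j. 1 \<le> i \<Longrightarrow> \<kappa> < \<bar>i - j\<bar> \<Longrightarrow> L i j = 0" "\<And>i. L i i = 0"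
    and ab: "a = 1 \<and> b = N \<or> a \<le> 1 - \<kappa> \<and> N + \<kappa> \<le> b"
  shows "\<bar>(\<Sum>i = 1..N. \<Sum>j = a..b. L i j) -
      (\<Sum>i = 1..N. \<Sum>m = 1..\<kappa>. L i (i + m) + L (i + m) i)\<bar> \<le> 3 * (real_of_int \<kappa>)\<^sup>2"
proof -
  let ?C = "{(i, j). (1 \<le> i \<and> i \<le> N \<and> i < j \<and> j \<le> i + \<kappa>) \<or> (1 \<le> j \<and> j \<le> N \<and> j < i \<and> i \<le> j + \<kappa>)}"
  \<comment> \<open>The possible mismatches. \<open>E1\<close>: links to nonpositive neighbours,
    which belong to no block but occur in the wide range. \<open>E2\<close>: links leaving 1..N to
    the right, which the blocks count and the narrow range does not. \<open>E3\<close>: links from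
    beyond N back into 1..N, which belong to blocks but to no row. Each set has \<kappa>^2 elements,
    whence the constant 3.\<close>
  define E1 where "E1 = {1..\<kappa>} \<times> {1 - \<kappa>..0}"
  define E2 where "E2 = {N - \<kappa> + 1..N} \<times> {N + 1..N + \<kappa>}"
  define E3 where "E3 = {N + 1..N + \<kappa>} \<times> {N - \<kappa> + 1..N}"
  have "\<bar>(\<Sum>(i, j)\<in>{1..N} \<times> {a..b}. L i j) - (\<Sum>(i, j)\<in>?C. L i j)\<bar> \<le> card (E1 \<union> E2 \<union> E3)"
  proof (rule abs_sum_diff_le_card)
    fix p assume p: "p \<in> ({1..N} \<times> {a..b} - ?C) \<union> (?C - {1..N} \<times> {a..b})"
      and nz: "(case p of (i, j) \<Rightarrow> L i j) \<noteq> 0"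
    obtain i j where ij: "p = (i, j)" by (cases p)
    have i1: "1 \<le> i" using p ij by auto
    have "\<not> \<kappa> < \<bar>i - j\<bar>" "i \<noteq> j" using nz zero(1)[OF i1, of j] zero(2)[of i] ij by auto
    then have "i - j \<le> \<kappa>" "j - i \<le> \<kappa>" "i \<noteq> j" by auto
    then show "p \<in> E1 \<union> E2 \<union> E3"
      using p ab i1 kappa unfolding ij E1_def E2_def E3_def Un_iff Diff_iff mem_Times_iff
        atLeastAtMost_iff mem_Collect_eq prod.case fst_conv snd_conv
      by (smt (verit))
  qed (use block_double_sum(1) L in \<open>auto simp: E1_def E2_def E3_def\<close>)
  also have "real (card (E1 \<union> E2 \<union> E3)) \<le> real (card E1 + card E2 + card E3)"
    using card_Un_le[of "E1 \<union> E2" E3] card_Un_le[of E1 E2] by linarith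
  also have "\<dots> = 3 * (real_of_int \<kappa>)\<^sup>2"
    using kappa by (simp add: E1_def E2_def E3_def card_cartesian_product power2_eq_square)
  finally show ?thesis unfolding block_double_sum(2) unfolding sum.cartesian_product .
qed

section \<open>Independence, laws and means in the network model\<close>

context network_model
begin

lemma measurable_zeta_unordered: "p \<in> unordered_pairs \<Longrightarrow> case_prod \<zeta> p \<in> borel_measurable M"
  using zeta_indep by (auto simp: indep_vars_def)

lemma up_in_unordered_pairs: "1 \<le> i \<Longrightarrow> up i j \<in> unordered_pairs"
  by (auto simp: up_def unordered_pairs_def)

lemma zeta_up: "1 \<le> i \<Longrightarrow> case_prod \<zeta> (up i j) = \<zeta> i j"
  using zeta_sym by (auto simp: up_def)

lemma measurable_zeta: "1 \<le> i \<Longrightarrow> \<zeta> i j \<in> borel_measurable M"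
  using measurable_zeta_unordered[OF up_in_unordered_pairs, of i j] by (simp add: zeta_up)

lemma measurable_eps: "1 \<le> i \<Longrightarrow> \<epsilon> i j \<in> borel_measurable M"
  using eps_indep by (auto simp: indep_vars_def pairs_def)

lemma noise_up: "1 \<le> i \<Longrightarrow> noise \<zeta> \<epsilon> (Inl (up i j)) = \<zeta> i j"
  by (simp add: noise_def zeta_up)

lemma noise_Inr: "noise \<zeta> \<epsilon> (Inr (i, j)) = \<epsilon> i j"
  by (simp add: noise_def)

text \<open>The assumption relates the full arrays over \<open>pairs\<close>; restricting the
  symmetric one to its representatives is measurable and preserves independence from
  \<open>\<epsilon>\<close>. Merging the two families is then
  \<open>indep_vars_Plus\<close>.\<close>

lemma noise_indep: "indep_vars (\<lambda>_. borel) (noise \<zeta> \<epsilon>) noise_index"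
proof -
  let ?r = "\<lambda>x :: int \<times> int \<Rightarrow> real. restrict x unordered_pairs"
  have sub: "unordered_pairs \<subseteq> pairs" by (auto simp: unordered_pairs_def pairs_def)
  have "indep_var (PiM unordered_pairs (\<lambda>_. borel)) (?r \<circ> (\<lambda>\<omega>. \<lambda>p\<in>pairs. \<zeta> (fst p) (snd p) \<omega>))
      (PiM pairs (\<lambda>_. borel)) (id \<circ> (\<lambda>\<omega>. \<lambda>p\<in>pairs. \<epsilon> (fst p) (snd p) \<omega>))"
    by (rule indep_var_compose[OF zeta_eps_indep measurable_restrict_subset[OF sub] measurable_ident])
  moreover have "?r \<circ> (\<lambda>\<omega>. \<lambda>p\<in>pairs. \<zeta> (fst p) (snd p) \<omega>) =
      (\<lambda>\<omega>. \<lambda>p\<in>unordered_pairs. (case p of (i, j) \<Rightarrow> \<zeta> i j) \<omega>)"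
    using sub by (auto simp: fun_eq_iff restrict_def case_prod_beta)
  ultimately have "indep_vars (case_sum (\<lambda>_. borel) (\<lambda>_. borel))
      (case_sum (\<lambda>(i, j). \<zeta> i j) (\<lambda>(i, j). \<epsilon> i j)) noise_index"
    by (intro indep_vars_Plus zeta_indep eps_indep) (simp add: case_prod_beta)
  then show ?thesis unfolding noise_def
    by (rule iffD1[OF indep_vars_cong, rotated -1]) (auto split: sum.split)
qed

lemma measurable_link: "1 \<le> i \<Longrightarrow> link \<kappa> \<zeta> \<epsilon> i j \<in> borel_measurable M"
  by (cases "i = j") (simp_all add: link_eq[abs_def] measurable_link_fun measurable_zeta measurable_eps)

lemma integrable_link: "1 \<le> i \<Longrightarrow> integrable M (link \<kappa> \<zeta> \<epsilon> i j)"
  by (intro integrable_const_bound[where B = 1] measurable_link) (auto simp: link_bounds)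

lemma AE_zeta_bounds:
  assumes "1 \<le> i"
  shows "AE \<omega> in M. real_of_int \<bar>i - j\<bar> - 1 \<le> \<zeta> i j \<omega> \<and> \<zeta> i j \<omega> < real_of_int \<bar>i - j\<bar>"
proof -
  have "AE x in distr M borel (\<zeta> i j). x \<in> {real_of_int \<bar>i - j\<bar> - 1 ..< real_of_int \<bar>i - j\<bar>}"
    unfolding zeta_uniform[OF assms] by (rule AE_uniform_measureI) auto
  then show ?thesis
    by (subst (asm) AE_distr_iff) (use measurable_zeta[OF assms] in auto)
qed

text \<open>All quantities are integers, so \<kappa> < |i - j| gives \<kappa> \<le> |i - j| - 1, the
  left end of the interval carrying \<open>\<zeta> i j\<close>. As there are countably many pairs,
  one null set serves for all of them.\<close>

lemma AE_link_zero:
  "AE \<omega> in M. \<forall>i j. 1 \<le> i \<longrightarrow> \<kappa> < \<bar>i - j\<bar> \<longrightarrow> link \<kappa> \<zeta> \<epsilon> i j \<omega> = 0"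
  unfolding AE_all_countable
proof (intro allI)
  fix i j
  show "AE \<omega> in M. 1 \<le> i \<longrightarrow> \<kappa> < \<bar>i - j\<bar> \<longrightarrow> link \<kappa> \<zeta> \<epsilon> i j \<omega> = 0"
  proof (cases "1 \<le> i \<and> \<kappa> < \<bar>i - j\<bar>")
    case True
    then have "real_of_int \<kappa> \<le> real_of_int \<bar>i - j\<bar> - 1" by linarith
    then show ?thesis
      using AE_zeta_bounds[of i j] True by (auto elim!: eventually_mono simp: link_def)
  qed auto
qed

lemma distr_eps_eq:
  assumes "1 \<le> i" "1 \<le> i'"
  shows "distr M borel (\<epsilon> i j) = distr M borel (\<epsilon> i' j')"
  using assms by (intro cdf_unique real_distribution_distr measurable_eps) (simp_all add: eps_logistic)

lemma indep_zeta_eps: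
  assumes "1 \<le> i"
  shows "indep_var borel (\<zeta> i j) borel (\<epsilon> i j)"
proof -
  let ?A = "{Inl (up i j)} :: ((int \<times> int) + (int \<times> int)) set" and ?B = "{Inr (i, j)}"
  have "indep_var (PiM ?A (\<lambda>_. borel)) (\<lambda>\<omega>. \<lambda>t\<in>?A. noise \<zeta> \<epsilon> t \<omega>)
      (PiM ?B (\<lambda>_. borel)) (\<lambda>\<omega>. \<lambda>t\<in>?B. noise \<zeta> \<epsilon> t \<omega>)"
    using assms up_in_unordered_pairs by (intro indep_var_restrict[OF noise_indep]) (auto simp: pairs_def)
  from indep_var_compose[OF this, of "\<lambda>x. x (Inl (up i j))" borel "\<lambda>x. x (Inr (i, j))" borel]
  show ?thesis using assms by (simp add: comp_def noise_up noise_Inr)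
qed

text \<open>By independence the joint law of \<open>\<zeta> i j\<close> and
  \<open>\<epsilon> i j\<close> is a product of a uniform law depending on the distance only and the
  common logistic law.\<close>

lemma expectation_link_cong:
  assumes "1 \<le> i" "1 \<le> i'" "\<bar>i - j\<bar> = \<bar>i' - j'\<bar>"
  shows "expectation (link \<kappa> \<zeta> \<epsilon> i j) = expectation (link \<kappa> \<zeta> \<epsilon> i' j')"
proof (cases "i = j")
  case True
  then have "i' = j'" using assms(3) by simp
  then show ?thesis using True by (simp add: link_def[abs_def])
next
  case False
  have joint: "expectation (link \<kappa> \<zeta> \<epsilon> i j) =
      (\<integral>p. link_fun \<kappa> (fst p) (snd p) \<partial>(distr M borel (\<zeta> i j) \<Otimes>\<^sub>M distr M borel (\<epsilon> i j)))"
    if "1 \<le> i" "i \<noteq> j" for i j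
  proof -
    have [measurable]: "\<zeta> i j \<in> borel_measurable M" "\<epsilon> i j \<in> borel_measurable M"
      using that measurable_zeta measurable_eps by auto
    have "expectation (link \<kappa> \<zeta> \<epsilon> i j) = expectation (\<lambda>\<omega>. link_fun \<kappa> (\<zeta> i j \<omega>) (\<epsilon> i j \<omega>))"
      using that by (simp add: link_eq[abs_def])
    also have "\<dots> = (\<integral>p. link_fun \<kappa> (fst p) (snd p) \<partial>(distr M (borel \<Otimes>\<^sub>M borel) (\<lambda>\<omega>. (\<zeta> i j \<omega>, \<epsilon> i j \<omega>))))"
      by (subst integral_distr) simp_all
    also have "distr M (borel \<Otimes>\<^sub>M borel) (\<lambda>\<omega>. (\<zeta> i j \<omega>, \<epsilon> i j \<omega>)) =
        distr M borel (\<zeta> i j) \<Otimes>\<^sub>M distr M borel (\<epsilon> i j)"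
      using indep_zeta_eps[OF that(1), of j] by (simp add: indep_var_distribution_eq)
    finally show ?thesis .
  qed
  have "i' \<noteq> j'" using False assms(3) by auto
  then show ?thesis
    using joint[of i j] joint[of i' j'] False assms distr_eps_eq[of i i' j j']
      zeta_uniform[of i j] zeta_uniform[of i' j'] by simp
qed

definition link_mean :: "int \<Rightarrow> int \<Rightarrow> real" where
  "link_mean \<kappa> m = expectation (link \<kappa> \<zeta> \<epsilon> 1 (1 + m))"

lemma expectation_link: "1 \<le> i \<Longrightarrow> expectation (link \<kappa> \<zeta> \<epsilon> i j) = link_mean \<kappa> \<bar>i - j\<bar>"
  unfolding link_mean_def by (rule expectation_link_cong) auto

lemma link_mean_0: "link_mean \<kappa> 0 = 0"
  by (simp add: link_mean_def link_def[abs_def])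

lemma link_mean_beyond:
  assumes "\<kappa> < m"
  shows "link_mean \<kappa> m = 0"
proof -
  have "AE \<omega> in M. link \<kappa> \<zeta> \<epsilon> 1 (1 + m) \<omega> = 0"
    using AE_link_zero[of \<kappa>] assms by (auto elim!: eventually_mono)
  then have "expectation (link \<kappa> \<zeta> \<epsilon> 1 (1 + m)) = expectation (\<lambda>_. 0)"
    by (intro integral_cong_AE) (auto intro: measurable_link)
  then show ?thesis by (simp add: link_mean_def)
qed

definition full_mean :: "int \<Rightarrow> real" where
  "full_mean \<kappa> = 2 * (\<Sum>m = 1..\<kappa>. link_mean \<kappa> m)"

lemma expectation_v_full:
  assumes i: "1 \<le> i" "i \<le> int n" and kappa: "1 \<le> \<kappa>"
  shows "expectation (v_full \<kappa> \<zeta> \<epsilon> n i) = full_mean \<kappa>"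
proof -
  have "expectation (v_full \<kappa> \<zeta> \<epsilon> n i) = (\<Sum>j = - \<kappa> - 1..int n + \<kappa> + 1. link_mean \<kappa> \<bar>i - j\<bar>)"
    using i unfolding v_full_def[abs_def]
    by (subst Bochner_Integration.integral_sum) (auto intro!: integrable_link simp: expectation_link)
  \<comment> \<open>For every i in 1..n the summation range contains the whole window of radius
    \<kappa> around i; hence there is no boundary effect and the mean is the same for all
    agents.\<close>
  also have "\<dots> = (\<Sum>j = i - \<kappa>..i + \<kappa>. link_mean \<kappa> \<bar>i - j\<bar>)"
    using i kappa by (intro sum.mono_neutral_right) (auto intro!: link_mean_beyond)
  also have "\<dots> = (\<Sum>d = - \<kappa>..\<kappa>. link_mean \<kappa> \<bar>d\<bar>)"
    by (rule sum.reindex_bij_witness[of _ "\<lambda>d. i + d" "\<lambda>j. j - i"]) (auto simp: abs_minus_commute)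
  also have "{- \<kappa>..\<kappa>} = {- \<kappa>..- 1} \<union> {0} \<union> {1..\<kappa>}" using kappa by auto
  also have "(\<Sum>d\<in>\<dots>. link_mean \<kappa> \<bar>d\<bar>) =
      (\<Sum>d = - \<kappa>..- 1. link_mean \<kappa> \<bar>d\<bar>) + (\<Sum>d = 1..\<kappa>. link_mean \<kappa> \<bar>d\<bar>)"
    by (subst sum.union_disjoint, auto)+ (simp add: link_mean_0)
  also have "(\<Sum>d = - \<kappa>..- 1. link_mean \<kappa> \<bar>d\<bar>) = (\<Sum>d = 1..\<kappa>. link_mean \<kappa> \<bar>d\<bar>)"
    by (rule sum.reindex_bij_witness[of _ uminus uminus]) auto
  finally show ?thesis by (simp add: full_mean_def)
qed

text \<open>Compared with a full row, a block trades the outgoing links to the left for incoming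
  links from the right. Means depend on the distance only, so both have the same mean and blocks and
  rows can be centred alike.\<close>

lemma expectation_block_sum:
  assumes "1 \<le> i"
  shows "expectation (block_sum \<kappa> \<zeta> \<epsilon> i) = full_mean \<kappa>"
proof -
  have "expectation (block_sum \<kappa> \<zeta> \<epsilon> i) = (\<Sum>m = 1..\<kappa>. link_mean \<kappa> m + link_mean \<kappa> m)"
    using assms unfolding block_sum_def[abs_def]
    by (subst Bochner_Integration.integral_sum)
      (auto intro!: sum.cong simp: integrable_link expectation_link)
  then show ?thesis by (simp add: full_mean_def sum_distrib_left)
qed

section \<open>Blocks are independent and identically distributed\<close>

lemma block_sum_eq:
  assumes "1 \<le> i"
  shows "block_sum \<kappa> \<zeta> \<epsilon> i \<omega> = block_fun \<kappa> (\<lambda>t\<in>block_index \<kappa>. noise \<zeta> \<epsilon> (shift_index i t) \<omega>)"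
proof -
  \<comment> \<open>Both agents are at least 1, so symmetry lets the incoming link read the variable
    stored for the outgoing one.\<close>
  have "\<zeta> (i + m) i = \<zeta> i (i + m)" if "m \<in> {1..\<kappa>}" for m
    using that assms by (intro zeta_sym) auto
  then show ?thesis
    unfolding block_sum_def block_fun_def
    by (intro sum.cong refl)
      (auto simp: link_eq block_index_def shift_index_def noise_def add.commute)
qed

lemma shift_block_index:
  assumes "1 \<le> i"
  shows "shift_index i ` block_index \<kappa> \<subseteq> noise_index"
  using assms by (auto simp: shift_index_def block_index_def unordered_pairs_def pairs_def)

lemma inj_shift_index: "inj (shift_index i)"
  unfolding shift_index_def by (intro sum.inj_map) (auto simp: inj_on_def)

text \<open>The smaller coordinate of every index in a shifted block is the agent itself.\<close>

lemma disjoint_blocks: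
  assumes "i \<noteq> i'"
  shows "shift_index i ` block_index \<kappa> \<inter> shift_index i' ` block_index \<kappa> = {}"
  using assms by (auto simp: shift_index_def block_index_def)

lemma block_sum_indep:
  "indep_vars (\<lambda>_. borel) (\<lambda>k. block_sum \<kappa> \<zeta> \<epsilon> (int (Suc k))) UNIV"
proof -
  let ?K = "\<lambda>k. shift_index (int (Suc k)) ` block_index \<kappa>"
  have "indep_vars (\<lambda>k. PiM (?K k) (\<lambda>_. borel)) (\<lambda>k \<omega>. \<lambda>t\<in>?K k. noise \<zeta> \<epsilon> t \<omega>) UNIV"
    by (rule indep_vars_restrict[OF noise_indep shift_block_index])
      (auto simp: disjoint_family_on_def intro!: disjoint_blocks)
  then have "indep_vars (\<lambda>_. borel) (\<lambda>k \<omega>. block_fun \<kappa>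
      (\<lambda>t\<in>block_index \<kappa>. (\<lambda>t\<in>?K k. noise \<zeta> \<epsilon> t \<omega>) (shift_index (int (Suc k)) t))) UNIV"
    by (rule indep_vars_compose2)
      (intro measurable_compose[OF _ measurable_block_fun] measurable_restrict
        measurable_component_singleton imageI)
  also have "(\<lambda>k \<omega>. block_fun \<kappa>
      (\<lambda>t\<in>block_index \<kappa>. (\<lambda>t\<in>?K k. noise \<zeta> \<epsilon> t \<omega>) (shift_index (int (Suc k)) t))) =
      (\<lambda>k. block_sum \<kappa> \<zeta> \<epsilon> (int (Suc k)))"
    by (intro ext, subst block_sum_eq) (auto intro!: arg_cong[where f = "block_fun \<kappa>"])
  finally show ?thesis .
qed

lemma distr_noise_shift:
  assumes "1 \<le> i" "1 \<le> i'" "t \<in> block_index \<kappa>"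
  shows "distr M borel (noise \<zeta> \<epsilon> (shift_index i t)) = distr M borel (noise \<zeta> \<epsilon> (shift_index i' t))"
proof (cases t)
  case (Inl p)
  then show ?thesis using assms
    by (auto simp: block_index_def shift_index_def noise_def zeta_uniform)
next
  case (Inr p)
  then show ?thesis using assms
    by (auto simp: block_index_def shift_index_def noise_def intro!: distr_eps_eq)
qed

text \<open>By independence the law of a block is the image under \<open>block_fun\<close> of a
  product of marginals, and translation changes none of the marginals.\<close>

lemma distr_block_sum:
  assumes i: "1 \<le> i" "1 \<le> i'" and kappa: "1 \<le> \<kappa>"
  shows "distr M borel (block_sum \<kappa> \<zeta> \<epsilon> i) = distr M borel (block_sum \<kappa> \<zeta> \<epsilon> i')"
proof -
  let ?D = "block_index \<kappa>"
  have *: "distr M borel (block_sum \<kappa> \<zeta> \<epsilon> i) =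
      distr (PiM ?D (\<lambda>t. distr M borel (noise \<zeta> \<epsilon> (shift_index i t)))) borel (block_fun \<kappa>)"
    if i: "1 \<le> i" for i
  proof -
    \<comment> \<open>Reindexing along the injective shift: each \<open>t\<close> is given the
      singleton of its image, and these singletons are disjoint.\<close>
    have "indep_vars (\<lambda>t. PiM {shift_index i t} (\<lambda>_. borel)) (\<lambda>t \<omega>. \<lambda>u\<in>{shift_index i t}. noise \<zeta> \<epsilon> u \<omega>) ?D"
      using shift_block_index[OF i, of \<kappa>] injD[OF inj_shift_index[of i]]
      by (intro indep_vars_restrict[OF noise_indep]) (auto simp: disjoint_family_on_def)
    then have "indep_vars (\<lambda>_. borel) (\<lambda>t \<omega>. (\<lambda>u\<in>{shift_index i t}. noise \<zeta> \<epsilon> u \<omega>) (shift_index i t)) ?D"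
      by (rule indep_vars_compose2) (rule measurable_component_singleton, simp)
    then have ind: "indep_vars (\<lambda>_. borel) (\<lambda>t. noise \<zeta> \<epsilon> (shift_index i t)) ?D" by simp
    then have rv: "noise \<zeta> \<epsilon> (shift_index i t) \<in> borel_measurable M" if "t \<in> ?D" for t
      using that by (auto simp: indep_vars_def)
    have ne: "?D \<noteq> {}" using kappa by (auto simp: block_index_def)
    have joint: "distr M (PiM ?D (\<lambda>_. borel)) (\<lambda>\<omega>. \<lambda>t\<in>?D. noise \<zeta> \<epsilon> (shift_index i t) \<omega>) =
        PiM ?D (\<lambda>t. distr M borel (noise \<zeta> \<epsilon> (shift_index i t)))"
      using ind rv by (subst (asm) indep_vars_iff_distr_eq_PiM'[OF ne]) auto
    have "block_sum \<kappa> \<zeta> \<epsilon> i = block_fun \<kappa> \<circ> (\<lambda>\<omega>. \<lambda>t\<in>?D. noise \<zeta> \<epsilon> (shift_index i t) \<omega>)"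
      by (rule ext) (simp add: block_sum_eq[OF i])
    then have "distr M borel (block_sum \<kappa> \<zeta> \<epsilon> i) =
        distr M borel (block_fun \<kappa> \<circ> (\<lambda>\<omega>. \<lambda>t\<in>?D. noise \<zeta> \<epsilon> (shift_index i t) \<omega>))" by simp
    also have "\<dots> = distr (distr M (PiM ?D (\<lambda>_. borel)) (\<lambda>\<omega>. \<lambda>t\<in>?D. noise \<zeta> \<epsilon> (shift_index i t) \<omega>))
        borel (block_fun \<kappa>)"
      using rv by (intro distr_distr[symmetric] measurable_block_fun measurable_restrict)
    finally show ?thesis unfolding joint .
  qed
  show ?thesis
    unfolding *[OF i(1)] *[OF i(2)]
    by (intro arg_cong[where f = "\<lambda>N. distr N borel (block_fun \<kappa>)"] PiM_cong refl
        distr_noise_shift i)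
qed

section \<open>Conditional mean of a row given the distant agents\<close>

text \<open>A general finite range \<open>R\<close> covers both statistics. The generator of an
  agent j within distance \<kappa> is 0 almost surely. That of a more distant j reads row j and
  \<open>\<zeta> i j\<close>, and neither meets row i once rows are cut to radius \<kappa>.\<close>

lemma real_cond_exp_distant:
  fixes R :: "int set" and \<kappa> :: int
  defines "s \<equiv> \<lambda>i \<omega>. \<Sum>j\<in>R. link \<kappa> \<zeta> \<epsilon> i j \<omega>"
  assumes R: "finite R" and i: "1 \<le> i" "i \<le> int n" and k: "real_of_int \<kappa> < k"
  shows "AE \<omega> in M. real_cond_exp M (distant_sigma M \<zeta> s k n i) (s i) \<omega> = expectation (s i)"
proof -
  define N where "N j = {l \<in> R. \<bar>j - l\<bar> \<le> \<kappa>}" for j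
  define J where "J = {j \<in> {1..int n}. \<kappa> < \<bar>i - j\<bar>}"
  define A where "A = row_index i (N i)"
  \<comment> \<open>The inserted variable is the one inside the indicator. It involves agent i but
    not row i, because j is farther than \<kappa> from i.\<close>
  define B where "B = (\<Union>j\<in>J. insert (Inl (up i j)) (row_index j (N j)))"
  let ?W = "\<lambda>T \<omega>. \<lambda>t\<in>T. noise \<zeta> \<epsilon> t \<omega>"
  have s_meas: "s j \<in> borel_measurable M" if "1 \<le> j" for j
    unfolding s_def using that by (auto intro!: borel_measurable_sum measurable_link)
  have row_eq: "AE \<omega> in M. s j \<omega> = row_fun \<kappa> (N j) j (?W T \<omega>)"
    if j: "1 \<le> j" and T: "row_index j (N j) \<subseteq> T" for j T
    using AE_link_zero[of \<kappa>]
  proof eventually_elim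
    case (elim \<omega>)
    then have near: "link \<kappa> \<zeta> \<epsilon> j l \<omega> \<noteq> 0 \<Longrightarrow> \<bar>j - l\<bar> \<le> \<kappa>" for l
      using j not_le by blast
    have "s j \<omega> = (\<Sum>l\<in>N j - {j}. link \<kappa> \<zeta> \<epsilon> j l \<omega>)"
      unfolding s_def N_def using R
      by (intro sum.mono_neutral_right) (auto simp: link_self dest: near)
    also have "\<dots> = row_fun \<kappa> (N j) j (?W T \<omega>)"
      unfolding row_fun_def using T j
      by (intro sum.cong refl) (auto simp: link_eq row_index_def noise_up noise_Inr)
    finally show ?case .
  qed
  have disj: "A \<inter> B = {}"
  proof (intro equals0I)
    fix t assume t: "t \<in> A \<inter> B"
    then obtain j where "j \<in> J" "t = Inl (up i j) \<or> t \<in> row_index j (N j)"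
      by (auto simp: B_def)
    with t show False
      by (auto simp: A_def J_def N_def row_index_def dest: up_eqD)
  qed
  have sub: "A \<subseteq> noise_index" "B \<subseteq> noise_index"
    using i up_in_unordered_pairs unfolding A_def B_def J_def row_index_def by (auto simp: pairs_def)
  have indep: "indep_var (PiM A (\<lambda>_. borel)) (?W A) (PiM B (\<lambda>_. borel)) (?W B)"
    using disj sub by (rule indep_var_restrict[OF noise_indep])
  define \<psi> where "\<psi> j x = (if j \<in> J then
      row_fun \<kappa> (N j) j x * (if k \<le> \<bar>x (Inl (up i j))\<bar> then 1 else 0) else 0)" for j x
  have psi: "\<psi> j \<in> borel_measurable (PiM B (\<lambda>_. borel))" for j
  proof (cases "j \<in> J")
    case True
    then have "Inl (up i j) \<in> B" "row_index j (N j) \<subseteq> B" by (auto simp: B_def)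
    then have [measurable]: "(\<lambda>x. x (Inl (up i j))) \<in> borel_measurable (PiM B (\<lambda>_. borel))"
      "row_fun \<kappa> (N j) j \<in> borel_measurable (PiM B (\<lambda>_. borel))"
      by (auto intro!: measurable_component_singleton measurable_row_fun)
    show ?thesis unfolding \<psi>_def using True by simp
  qed (simp add: \<psi>_def[abs_def])
  have g_le: "g \<zeta> i j \<omega> \<le> Lam k \<longleftrightarrow> k \<le> \<bar>\<zeta> i j \<omega>\<bar>" for j \<omega>
    by (simp add: g_def H_le_Lam_iff)
  let ?X = "\<lambda>j \<omega>. s j \<omega> * of_bool (g \<zeta> i j \<omega> \<le> Lam k)"
  have X_meas: "?X j \<in> borel_measurable M" if "j \<in> {1..int n} - {i}" for j
  proof -
    have [measurable]: "s j \<in> borel_measurable M" "\<zeta> i j \<in> borel_measurable M"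
      using that i s_meas measurable_zeta by auto
    show ?thesis unfolding g_le of_bool_def by measurable
  qed
  have X_eq: "AE \<omega> in M. ?X j \<omega> = \<psi> j (?W B \<omega>)" if j: "j \<in> {1..int n} - {i}" for j
  proof (cases "j \<in> J")
    case True
    then have B: "Inl (up i j) \<in> B" "row_index j (N j) \<subseteq> B" by (auto simp: B_def)
    have "1 \<le> j" using j by simp
    from row_eq[OF this B(2)] show ?thesis
      by eventually_elim (use True B i in \<open>simp add: \<psi>_def g_le noise_up\<close>)
  next
    case False
    \<comment> \<open>Distance at least 1 makes \<open>\<zeta> i j\<close> nonnegative, so its
      absolute value is below |i - j| \<le> \<kappa> < k and the indicator vanishes.\<close>
    then have d: "real_of_int \<bar>i - j\<bar> \<le> real_of_int \<kappa>" "1 \<le> real_of_int \<bar>i - j\<bar>"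
      using j by (auto simp: J_def)
    have "AE \<omega> in M. \<not> k \<le> \<bar>\<zeta> i j \<omega>\<bar>"
      using AE_zeta_bounds[OF i(1), of j] by eventually_elim (use d k in linarith)
    then show ?thesis by eventually_elim (use False in \<open>simp add: \<psi>_def g_le\<close>)
  qed
  show ?thesis
    unfolding distant_sigma_def
  proof (rule real_cond_exp_gen_sigma_indep[OF indep _ _ _ X_meas X_eq psi])
    show "integrable M (s i)"
      unfolding s_def using i(1) by (auto intro!: Bochner_Integration.integrable_sum integrable_link)
    show "AE \<omega> in M. s i \<omega> = row_fun \<kappa> (N i) i (?W A \<omega>)"
      using i(1) by (rule row_eq) (simp add: A_def)
    show "row_fun \<kappa> (N i) i \<in> borel_measurable (PiM A (\<lambda>_. borel))"
      by (rule measurable_row_fun) (simp add: A_def)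
  qed
qed

lemma AE_cond_norm2_zero:
  assumes [measurable]: "x \<in> borel_measurable M" and zero: "AE \<omega> in M. x \<omega> = 0"
  shows "AE \<omega> in M. cond_norm2 M \<zeta> x \<omega> = 0"
proof -
  interpret Z: sigma_finite_subalgebra M "gen_sigma M pairs (\<lambda>(i, j). \<zeta> i j)"
    by (rule sigma_finite_subalgebra_gen_sigma) (auto simp: pairs_def intro: measurable_zeta)
  have "AE \<omega> in M. real_cond_exp M (gen_sigma M pairs (\<lambda>(i, j). \<zeta> i j)) (\<lambda>\<omega>'. \<bar>x \<omega>'\<bar>\<^sup>2) \<omega> =
      real_cond_exp M (gen_sigma M pairs (\<lambda>(i, j). \<zeta> i j)) (\<lambda>_. 0) \<omega>"
    by (rule Z.real_cond_exp_cong) (use zero in auto)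
  moreover have "AE \<omega> in M. real_cond_exp M (gen_sigma M pairs (\<lambda>(i, j). \<zeta> i j)) (\<lambda>_. 0) \<omega> = 0"
    by (rule Z.real_cond_exp_F_meas) auto
  ultimately show ?thesis
    by eventually_elim (simp add: cond_norm2_def)
qed

section \<open>Limit theorems by comparison with block sums\<close>

lemma AE_row_sums_close:
  assumes kappa: "1 \<le> \<kappa>" and ab: "a = 1 \<and> b = int n \<or> a \<le> 1 - \<kappa> \<and> int n + \<kappa> \<le> b"
  shows "AE \<omega> in M. \<bar>(\<Sum>i = 1..int n. \<Sum>j = a..b. link \<kappa> \<zeta> \<epsilon> i j \<omega>) -
      (\<Sum>i = 1..int n. block_sum \<kappa> \<zeta> \<epsilon> i \<omega>)\<bar> \<le> 3 * (real_of_int \<kappa>)\<^sup>2"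
  using AE_link_zero[of \<kappa>]
proof eventually_elim
  case (elim \<omega>)
  show ?case unfolding block_sum_def
  proof (rule banded_sum_boundary[OF _ link_bounds _ link_self ab])
    show "0 \<le> \<kappa>" using kappa by simp
    show "link \<kappa> \<zeta> \<epsilon> i j \<omega> = 0" if "1 \<le> i" "\<kappa> < \<bar>i - j\<bar>" for i j
      using elim that by blast
  qed
qed

end

lemma sum_1_to_int: "(\<Sum>i = 1..int n. f i) = (\<Sum>k<n. f (int (Suc k)))"
  by (rule sum.reindex_bij_witness[of _ "\<lambda>k. int (Suc k)" "\<lambda>i. nat (i - 1)"]) auto

lemma (in prob_space) abs_expectation_le:
  fixes f :: "'a \<Rightarrow> real"
  assumes "f \<in> borel_measurable M" "AE \<omega> in M. \<bar>f \<omega>\<bar> \<le> c"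
  shows "\<bar>expectation f\<bar> \<le> c"
proof -
  have "integrable M f" using assms by (intro integrable_const_bound[where B = c]) auto
  then have "- c \<le> expectation f" "expectation f \<le> c"
    using assms(2) by (auto intro!: integral_ge_const integral_le_const elim!: eventually_mono)
  then show ?thesis by linarith
qed

context network_model
begin

text \<open>The error \<open>c\<close> does not grow with n, so it disappears after division by n
  and by the square root of n. Any two statistics near the block sums thus have the same limit law,
  with the variance of a single block.\<close>

lemma limits_near_block_sums:
  assumes kappa: "1 \<le> \<kappa>"
    and D [measurable]: "\<And>n. D n \<in> borel_measurable M"
    and close: "\<And>n. AE \<omega> in M.
      \<bar>D n \<omega> - (\<Sum>k<n. block_sum \<kappa> \<zeta> \<epsilon> (int (Suc k)) \<omega> - full_mean \<kappa>)\<bar> \<le> c"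
  shows "AE \<omega> in M. (\<lambda>n. D n \<omega> / real n) \<longlonglongrightarrow> 0"
    and "weak_conv_m (\<lambda>n. distr M borel (\<lambda>\<omega>. D n \<omega> / sqrt (real n)))
      (normal_law 0 (variance (block_sum \<kappa> \<zeta> \<epsilon> 1)))"
proof -
  define X where "X k = block_sum \<kappa> \<zeta> \<epsilon> (int (Suc k))" for k
  have X0: "X 0 = block_sum \<kappa> \<zeta> \<epsilon> 1" by (simp add: X_def)
  have indep: "indep_vars (\<lambda>_. borel) X UNIV" unfolding X_def by (rule block_sum_indep)
  then have [measurable]: "X k \<in> borel_measurable M" for k by (auto simp: indep_vars_def)
  have bdd: "\<bar>X k \<omega>\<bar> \<le> 2 * real (nat \<kappa>)" for k \<omega> unfolding X_def by (rule block_sum_bounds)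
  have mean: "expectation (X k) = full_mean \<kappa>" for k
    unfolding X_def by (rule expectation_block_sum) simp
  have distr: "distr M borel (X k) = distr M borel (X 0)" for k
    unfolding X_def using kappa by (intro distr_block_sum) auto
  have close': "AE \<omega> in M. \<bar>D n \<omega> - (\<Sum>k<n. X k \<omega> - full_mean \<kappa>)\<bar> \<le> c" for n
    using close[of n] by (simp add: X_def)
  have c: "0 \<le> c"
  proof -
    have "AE \<omega> in M. 0 \<le> c" using close'[of 0] by eventually_elim linarith
    then show ?thesis by simp
  qed
  have "AE \<omega> in M. \<forall>n. \<bar>D n \<omega> - (\<Sum>k<n. X k \<omega> - full_mean \<kappa>)\<bar> \<le> c"
    using close' by (simp add: AE_all_countable)
  moreover have "AE \<omega> in M. (\<lambda>n. (\<Sum>k<n. X k \<omega>) / real n) \<longlonglongrightarrow> full_mean \<kappa>"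
    using indep bdd mean by (rule strong_law_bounded)
  ultimately show "AE \<omega> in M. (\<lambda>n. D n \<omega> / real n) \<longlonglongrightarrow> 0"
  proof eventually_elim
    case (elim \<omega>)
    let ?S = "\<lambda>n. \<Sum>k<n. X k \<omega>"
    have "(\<lambda>n. D n \<omega> / real n - (?S n / real n - full_mean \<kappa>)) \<longlonglongrightarrow> 0"
    proof (rule Lim_null_comparison)
      show "\<forall>\<^sub>F n in sequentially. norm (D n \<omega> / real n - (?S n / real n - full_mean \<kappa>)) \<le> c / real n"
        using eventually_ge_at_top[of 1]
      proof eventually_elim
        case n: (elim n)
        have "D n \<omega> / real n - (?S n / real n - full_mean \<kappa>) =
            (D n \<omega> - (\<Sum>k<n. X k \<omega> - full_mean \<kappa>)) / real n"
          using n by (simp add: sum_subtractf field_simps)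
        then show ?case
          using elim(1)[rule_format, of n] by (simp add: divide_right_mono)
      qed
      show "(\<lambda>n. c / real n) \<longlonglongrightarrow> 0" by (rule lim_const_over_n)
    qed
    moreover have "(\<lambda>n. ?S n / real n - full_mean \<kappa>) \<longlonglongrightarrow> full_mean \<kappa> - full_mean \<kappa>"
      using elim(2) by (intro tendsto_intros)
    ultimately show ?case using tendsto_add by fastforce
  qed
  have "weak_conv_m (\<lambda>n. distr M borel (\<lambda>\<omega>. (\<Sum>k<n. X k \<omega> - expectation (X 0)) / sqrt (real n)))
      (normal_law 0 (variance (X 0)))"
  proof (rule central_limit_normal_law[OF indep distr])
    have "(X 0 \<omega>)\<^sup>2 \<le> (2 * real (nat \<kappa>))\<^sup>2" for \<omega>
      using bdd[of 0 \<omega>] by (intro abs_le_square_iff[THEN iffD1]) simp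
    then show "integrable M (\<lambda>\<omega>. (X 0 \<omega>)\<^sup>2)"
      by (intro integrable_const_bound[where B = "(2 * real (nat \<kappa>))\<^sup>2"]) auto
  qed
  then have conv: "weak_conv_m (\<lambda>n. distr M borel (\<lambda>\<omega>. (\<Sum>k<n. X k \<omega> - full_mean \<kappa>) / sqrt (real n)))
      (normal_law 0 (variance (X 0)))"
    unfolding mean[of 0] .
  have "weak_conv_m (\<lambda>n. distr M borel (\<lambda>\<omega>. D n \<omega> / sqrt (real n))) (normal_law 0 (variance (X 0)))"
  proof (rule weak_conv_m_AE_close[OF _ _ _ _ _ conv])
    show "AE \<omega> in M. \<bar>(\<Sum>k<n. X k \<omega> - full_mean \<kappa>) / sqrt (real n) - D n \<omega> / sqrt (real n)\<bar> \<le>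
        c / sqrt (real n)" for n
      using close'[of n]
    proof eventually_elim
      case (elim \<omega>)
      then show ?case
        unfolding diff_divide_distrib[symmetric] abs_divide
        by (simp add: divide_right_mono abs_minus_commute)
    qed
    show "(\<lambda>n. c / sqrt (real n)) \<longlonglongrightarrow> 0"
      by (intro tendsto_divide_0[OF tendsto_const] filterlim_at_top_imp_at_infinity
          filterlim_compose[OF sqrt_at_top] filterlim_real_sequentially)
    show "real_distribution (normal_law 0 (variance (X 0)))"
      by (intro real_distribution_normal_law variance_positive)
  qed simp_all
  then show "weak_conv_m (\<lambda>n. distr M borel (\<lambda>\<omega>. D n \<omega> / sqrt (real n)))
      (normal_law 0 (variance (block_sum \<kappa> \<zeta> \<epsilon> 1)))"
    unfolding X0 .
qed

lemma AE_cond_norm2_row_sum: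
  fixes R :: "int set" and \<kappa> :: int
  assumes s: "s = (\<lambda>i \<omega>. \<Sum>j\<in>R. link \<kappa> \<zeta> \<epsilon> i j \<omega>)"
    and R: "finite R" and i: "i \<in> {1..int n}" and k: "real_of_int \<kappa> < k"
  shows "AE \<omega> in M. cond_norm2 M \<zeta>
    (\<lambda>\<omega>'. expectation (s i) - real_cond_exp M (distant_sigma M \<zeta> s k n i) (s i) \<omega>') \<omega> = 0"
proof (rule AE_cond_norm2_zero)
  have "AE \<omega> in M. real_cond_exp M (distant_sigma M \<zeta> s k n i) (s i) \<omega> = expectation (s i)"
    unfolding s using i by (intro real_cond_exp_distant[OF R _ _ k]) auto
  then show "AE \<omega> in M. expectation (s i) -
      real_cond_exp M (distant_sigma M \<zeta> s k n i) (s i) \<omega> = 0"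
    by eventually_elim simp
qed simp

end

section \<open>The strong law and the normal limit for both statistics\<close>

theorem proposition3:
  fixes M :: "'a measure" and \<zeta> \<epsilon> :: "int \<Rightarrow> int \<Rightarrow> 'a \<Rightarrow> real" and \<kappa> :: int and K :: real
    and v_n v :: "nat \<Rightarrow> int \<Rightarrow> 'a \<Rightarrow> real" and \<mu>_n \<mu>_i :: "nat \<Rightarrow> int \<Rightarrow> real"
  assumes model: "network_model M \<zeta> \<epsilon>"
    and kappa: "\<kappa> \<ge> 1"
    and v_n: "v_n = v_trunc \<kappa> \<zeta> \<epsilon>"
    and v: "v = v_full \<kappa> \<zeta> \<epsilon>"
    and mu_n: "\<mu>_n = (\<lambda>n i. \<integral>\<omega>. v_n n i \<omega> \<partial>M)"
    and mu_i: "\<mu>_i = (\<lambda>n i. \<integral>\<omega>. v n i \<omega> \<partial>M)"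
    and bound: "\<And>n. n \<ge> 1 \<Longrightarrow>
      (SUP i\<in>{1..int n}. \<bar>\<mu>_n n i\<bar> + sqrt (\<integral>\<omega>. (v_n n i \<omega>)\<^sup>2 \<partial>M)) \<le> K"
  shows "\<exists>\<mu>.
      (\<forall>n. \<forall>i\<in>{1..int n}. \<mu>_i n i = \<mu>) \<and>
      (\<forall>n. \<forall>i\<in>{1..int n}. \<forall>k > real_of_int \<kappa>.
         (AE \<omega> in M. cond_norm2 M \<zeta>
            (\<lambda>\<omega>'. \<mu>_n n i - real_cond_exp M (distant_sigma M \<zeta> (v_n n) k n i) (v_n n i) \<omega>') \<omega> = 0) \<and>
         (AE \<omega> in M. cond_norm2 M \<zeta>
            (\<lambda>\<omega>'. \<mu>_i n i - real_cond_exp M (distant_sigma M \<zeta> (v n) k n i) (v n i) \<omega>') \<omega> = 0)) \<and>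
      (AE \<omega> in M. (\<lambda>n. (\<Sum>i = 1..int n. v_n n i \<omega> - \<mu>_n n i) / real n) \<longlonglongrightarrow> 0) \<and>
      (AE \<omega> in M. (\<lambda>n. (\<Sum>i = 1..int n. v n i \<omega>) / real n) \<longlonglongrightarrow> \<mu>) \<and>
      (\<exists>\<sigma>2 \<ge> 0.
         weak_conv_m
           (\<lambda>n. distr M borel (\<lambda>\<omega>. (\<Sum>i = 1..int n. v_n n i \<omega> - \<mu>_n n i) / sqrt (real n)))
           (normal_law 0 \<sigma>2) \<and>
         weak_conv_m
           (\<lambda>n. distr M borel (\<lambda>\<omega>. (\<Sum>i = 1..int n. v n i \<omega> - \<mu>) / sqrt (real n)))
           (normal_law 0 \<sigma>2))"
proof -
  interpret network_model M \<zeta> \<epsilon> by fact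
  define X where "X k = block_sum \<kappa> \<zeta> \<epsilon> (int (Suc k))" for k
  let ?\<mu> = "full_mean \<kappa>"
  let ?B = "3 * (real_of_int \<kappa>)\<^sup>2"
  have v_n_eq: "v_n n = (\<lambda>i \<omega>. \<Sum>j = 1..int n. link \<kappa> \<zeta> \<epsilon> i j \<omega>)" for n
    by (intro ext) (simp add: v_n v_trunc_def)
  have v_eq: "v n = (\<lambda>i \<omega>. \<Sum>j = - \<kappa> - 1..int n + \<kappa> + 1. link \<kappa> \<zeta> \<epsilon> i j \<omega>)" for n
    by (intro ext) (simp add: v v_full_def)
  have int_v_n: "integrable M (v_n n i)" if "1 \<le> i" for n i
    unfolding v_n_eq using that by (intro Bochner_Integration.integrable_sum integrable_link)
  have meas_v: "v n i \<in> borel_measurable M" if "1 \<le> i" for n i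
    unfolding v_eq using that by (intro borel_measurable_sum measurable_link)
  have meas_v_n: "v_n n i \<in> borel_measurable M" if "1 \<le> i" for n i
    using int_v_n[OF that] by simp
  have int_X: "integrable M (X k)" for k
    unfolding X_def block_sum_def[abs_def]
    by (intro Bochner_Integration.integrable_sum Bochner_Integration.integrable_add integrable_link) auto
  have mean_X: "expectation (X k) = ?\<mu>" for k
    unfolding X_def by (rule expectation_block_sum) simp
  have mu_i_eq: "\<mu>_i n i = ?\<mu>" if "i \<in> {1..int n}" for n i
    unfolding mu_i v using that kappa by (intro expectation_v_full) auto
  have sum_X: "(\<Sum>i = 1..int n. block_sum \<kappa> \<zeta> \<epsilon> i \<omega>) = (\<Sum>k<n. X k \<omega>)" for n \<omega>
    unfolding X_def by (rule sum_1_to_int)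
  have near_n: "AE \<omega> in M. \<bar>(\<Sum>i = 1..int n. v_n n i \<omega>) - (\<Sum>k<n. X k \<omega>)\<bar> \<le> ?B" for n
    using AE_row_sums_close[OF kappa, of 1 "int n" n] unfolding v_n_eq sum_X by simp
  have near: "AE \<omega> in M. \<bar>(\<Sum>i = 1..int n. v n i \<omega>) - (\<Sum>k<n. X k \<omega>)\<bar> \<le> ?B" for n
  proof -
    have "- \<kappa> - 1 \<le> 1 - \<kappa> \<and> int n + \<kappa> \<le> int n + \<kappa> + 1" by simp
    from AE_row_sums_close[OF kappa disjI2[OF this]] show ?thesis unfolding v_eq sum_X .
  qed
  \<comment> \<open>The means \<open>\<mu>_n n i\<close> do vary with i near the ends of the sample,
    but only their sum matters; integrating the almost sure estimate bounds its drift by the same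
    constant.\<close>
  have mean_near: "\<bar>(\<Sum>i = 1..int n. \<mu>_n n i) - real n * ?\<mu>\<bar> \<le> ?B" for n
  proof -
    have "integrable M (\<lambda>\<omega>. \<Sum>i = 1..int n. v_n n i \<omega>)" "integrable M (\<lambda>\<omega>. \<Sum>k<n. X k \<omega>)"
      using int_v_n int_X by (auto intro!: Bochner_Integration.integrable_sum)
    moreover have "expectation (\<lambda>\<omega>. \<Sum>i = 1..int n. v_n n i \<omega>) = (\<Sum>i = 1..int n. \<mu>_n n i)"
      unfolding mu_n by (rule Bochner_Integration.integral_sum) (simp add: int_v_n)
    moreover have "expectation (\<lambda>\<omega>. \<Sum>k<n. X k \<omega>) = real n * ?\<mu>"
      by (subst Bochner_Integration.integral_sum) (simp_all add: int_X mean_X)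
    ultimately have E: "expectation (\<lambda>\<omega>. (\<Sum>i = 1..int n. v_n n i \<omega>) - (\<Sum>k<n. X k \<omega>)) =
        (\<Sum>i = 1..int n. \<mu>_n n i) - real n * ?\<mu>" by simp
    have *: "(\<lambda>\<omega>. (\<Sum>i = 1..int n. v_n n i \<omega>) - (\<Sum>k<n. X k \<omega>)) \<in> borel_measurable M"
      using int_X by (intro borel_measurable_diff borel_measurable_sum meas_v_n
          borel_measurable_integrable) auto
    show ?thesis using abs_expectation_le[OF * near_n] unfolding E .
  qed
  \<comment> \<open>One \<open>?B\<close> comes from the statistics and one from their means. For
    \<open>v\<close> the centring is exact and a single \<open>?B\<close> remains.\<close>
  have dev_n: "AE \<omega> in M. \<bar>(\<Sum>i = 1..int n. v_n n i \<omega> - \<mu>_n n i) -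
      (\<Sum>k<n. block_sum \<kappa> \<zeta> \<epsilon> (int (Suc k)) \<omega> - ?\<mu>)\<bar> \<le> 2 * ?B" for n
    using near_n[of n]
  proof eventually_elim
    case (elim \<omega>)
    then show ?case using mean_near[of n] by (simp add: sum_subtractf X_def)
  qed
  have dev: "AE \<omega> in M. \<bar>(\<Sum>i = 1..int n. v n i \<omega> - ?\<mu>) -
      (\<Sum>k<n. block_sum \<kappa> \<zeta> \<epsilon> (int (Suc k)) \<omega> - ?\<mu>)\<bar> \<le> ?B" for n
    using near[of n] by eventually_elim (simp add: sum_subtractf X_def)
  have meas_n: "(\<lambda>\<omega>. \<Sum>i = 1..int n. v_n n i \<omega> - \<mu>_n n i) \<in> borel_measurable M" for n
    by (intro borel_measurable_sum borel_measurable_diff meas_v_n) auto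
  have meas: "(\<lambda>\<omega>. \<Sum>i = 1..int n. v n i \<omega> - ?\<mu>) \<in> borel_measurable M" for n
    by (intro borel_measurable_sum borel_measurable_diff meas_v) auto
  note lim_n = limits_near_block_sums[OF kappa meas_n dev_n]
  note lim = limits_near_block_sums[OF kappa meas dev]
  have slln: "AE \<omega> in M. (\<lambda>n. (\<Sum>i = 1..int n. v n i \<omega>) / real n) \<longlonglongrightarrow> ?\<mu>"
    using lim(1)
  proof eventually_elim
    case (elim \<omega>)
    have "(\<lambda>n. (\<Sum>i = 1..int n. v n i \<omega> - ?\<mu>) / real n + ?\<mu>) \<longlonglongrightarrow> 0 + ?\<mu>"
      using elim by (intro tendsto_intros)
    moreover have "eventually (\<lambda>n. (\<Sum>i = 1..int n. v n i \<omega> - ?\<mu>) / real n + ?\<mu> =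
        (\<Sum>i = 1..int n. v n i \<omega>) / real n) sequentially"
      using eventually_ge_at_top[of 1] by eventually_elim (simp add: sum_subtractf field_simps)
    ultimately show ?case by (simp add: tendsto_cong)
  qed
  have cond: "(AE \<omega> in M. cond_norm2 M \<zeta>
        (\<lambda>\<omega>'. \<mu>_n n i - real_cond_exp M (distant_sigma M \<zeta> (v_n n) k n i) (v_n n i) \<omega>') \<omega> = 0) \<and>
      (AE \<omega> in M. cond_norm2 M \<zeta>
        (\<lambda>\<omega>'. \<mu>_i n i - real_cond_exp M (distant_sigma M \<zeta> (v n) k n i) (v n i) \<omega>') \<omega> = 0)"
    if "i \<in> {1..int n}" "real_of_int \<kappa> < k" for n i k
    unfolding mu_n mu_i
    using AE_cond_norm2_row_sum[OF v_n_eq _ that] AE_cond_norm2_row_sum[OF v_eq _ that] by simp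
  have clt: "\<exists>\<sigma>2 \<ge> 0.
      weak_conv_m (\<lambda>n. distr M borel (\<lambda>\<omega>. (\<Sum>i = 1..int n. v_n n i \<omega> - \<mu>_n n i) / sqrt (real n)))
        (normal_law 0 \<sigma>2) \<and>
      weak_conv_m (\<lambda>n. distr M borel (\<lambda>\<omega>. (\<Sum>i = 1..int n. v n i \<omega> - ?\<mu>) / sqrt (real n)))
        (normal_law 0 \<sigma>2)"
    \<comment> \<open>The variance of a block includes the covariance of d_ij and d_ji through their
      common \<open>\<zeta>\<close> variable.\<close>
    by (intro exI[of _ "variance (block_sum \<kappa> \<zeta> \<epsilon> 1)"] conjI variance_positive lim_n(2) lim(2))
  show ?thesis
    by (intro exI[of _ ?\<mu>] conjI ballI allI impI clt slln lim_n(1) mu_i_eq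
        cond[THEN conjunct1] cond[THEN conjunct2])
qed

end
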